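(* Let $\Sigma_1=S_a\subset\mathbb{R}^3$ be the sphere of radius $a>0$ centred at the origin, and let $\Sigma_2$ be an arbitrary surface (the boundary of a rigid body) rolling on $S_a$, with configuration space $Q=S_a\times SO(3)\ni(q,R)$. Consider the principal bundle $SO(3)\hookrightarrow Q\to Q/SO(3)\cong S^2$ given by the diagonal action $S\cdot(q,R)=(Sq,SR)$, with projection $\pi(q,R)=R^{-1}q/a$. Then for any such rolling surface $\Sigma_2$ the no-slip and no-twist constraints define a principal bundle connection on this bundle, given by $$\omega=\frac qa\times\Big[dN_{g\Sigma_2}(q)\cdot\dot q+\frac{\dot q}{a}\Big].$$ In particular the constraints are equivariant: if $\omega$ satisfies $\omega\times q=[I+a\,dN_{g\Sigma_2}(q)]\dot q$ and $\omega\cdot q=0$, then for every $S\in SO(3)$ one has $S\omega\times Sq=[I+a\,dN_{Sg\Sigma_2}(Sq)](S\dot q)$ and $S\omega\cdot Sq=0$.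
   Context: The body is in standard position when its center of mass is at $0$ and its principal axes of inertia are the coordinate axes; its boundary in that position is $\Sigma_2$, with Gauss map $N_2:\Sigma_2\to S^2$, which is invertible (as is guaranteed, for instance, when the body is strictly convex), so that configurations are described by pairs $(q,R)$. $S_a$ is oriented by $N_1(q)=q/a$, and $\Sigma_2$ is oriented so that the two normals at the contact point are opposite: this is the exterior normal of $\Sigma_2$ when the surfaces roll externally to each other, and internal contact corresponds to the opposite orientation of $\Sigma_2$ (for a rolling sphere of radius $b$, to allowing $b$ to be negative). In configuration $(q,R)$, $q\in S_a$ is the contact point and $R$ is the attitude matrix of the rolling body; the contact point on the body in the body frame is $Q_2=N_2^{-1}(-R^{-1}N_1(q))$ and the center of mass is at $x=q-RQ_2$. $g=(R,x)\in SE(3)$ denotes the corresponding Euclidean motion (rotate by $R$, then translate by $x$), $Sg$ is its composition with the rotation $S$ about the origin, and $dN_{g\Sigma_2}(q)$ is the derivative at $q$ of the Gauss map of the displaced surface $g\Sigma_2$, an endomorphism of $T_qS_a$. The angular velocity in space $\omega\in\mathbb{R}^3$ is defined by $\dot RR^{-1}=[\omega]$, where $[\omega]v=\omega\times v$. No slip: $\dot x=\omega\times(x-q)$. No twist: $\omega\cdot N_1(q)=0$.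
   Formalization: The Gauss map of the rolling surface is assumed to be a diffeomorphism onto the sphere, not merely invertible; at a flat point (e.g. of x^4+y^4+z^4=1) the constraint distribution is not transverse to the fibres, so no connection is defined. *)

theory Defs
  imports "HOL-Analysis.Analysis"
begin

section \<open>Smooth maps and submanifolds of Euclidean spaces\<close>

primrec Ck_on ::
  "nat \<Rightarrow> 'a::real_normed_vector set \<Rightarrow> ('a \<Rightarrow> 'b::real_normed_vector) \<Rightarrow> bool" where
  "Ck_on 0 U f \<longleftrightarrow> continuous_on U f"
| "Ck_on (Suc k) U f \<longleftrightarrow>
     (\<forall>x\<in>U. f differentiable (at x)) \<and>
     (\<forall>v. Ck_on k U (\<lambda>x. frechet_derivative f (at x) v))"

(* Meant for open U in a finite-dimensional space. *)
definition smooth_on_open ::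
  "'a::real_normed_vector set \<Rightarrow> ('a \<Rightarrow> 'b::real_normed_vector) \<Rightarrow> bool" where
  "smooth_on_open U f \<longleftrightarrow> (\<forall>k. Ck_on k U f)"

(* A map on an arbitrary subset of a Euclidean space is smooth if it extends, locally, to a
   smooth map of the ambient space (Milnor, Guillemin-Pollack). *)
definition smooth_map ::
  "'a::euclidean_space set \<Rightarrow> ('a \<Rightarrow> 'b::euclidean_space) \<Rightarrow> bool" where
  "smooth_map M f \<longleftrightarrow>
     (\<forall>p\<in>M. \<exists>U F. open U \<and> p \<in> U \<and> smooth_on_open U F \<and> (\<forall>x\<in>M \<inter> U. F x = f x))"

definition diffeo ::
  "'a::euclidean_space set \<Rightarrow> 'b::euclidean_space set \<Rightarrow> ('a \<Rightarrow> 'b) \<Rightarrow> bool" where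
  "diffeo M M' f \<longleftrightarrow> bij_betw f M M' \<and> smooth_map M f \<and> smooth_map M' (inv_into M f)"

(* M is locally diffeomorphic to an open set of a k-dimensional space; that model space is
   taken to be a k-dimensional linear subspace L of the ambient space. *)
definition submanifold :: "nat \<Rightarrow> 'a::euclidean_space set \<Rightarrow> bool" where
  "submanifold k M \<longleftrightarrow>
     (\<forall>p\<in>M. \<exists>U (L :: 'a set) V \<phi>. open U \<and> p \<in> U \<and> subspace L \<and> dim L = k \<and>
        openin (top_of_set L) V \<and> diffeo V (M \<inter> U) \<phi>)"

definition curve_in ::
  "'a::euclidean_space set \<Rightarrow> 'a \<Rightarrow> 'a \<Rightarrow> (real \<Rightarrow> 'a) \<Rightarrow> bool" where
  "curve_in M p v \<gamma> \<longleftrightarrow>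
     (\<exists>e>0. smooth_on_open {-e<..<e} \<gamma> \<and> \<gamma> ` {-e<..<e} \<subseteq> M) \<and>
     \<gamma> 0 = p \<and> (\<gamma> has_vector_derivative v) (at 0)"

definition tangent_space :: "'a::euclidean_space set \<Rightarrow> 'a \<Rightarrow> 'a set" where
  "tangent_space M p = {v. \<exists>\<gamma>. curve_in M p v \<gamma>}"

(* The differential df(p) : T_p M \<rightarrow> T_{f p} M', meaningful for v in T_p M. *)
definition tangent_map ::
  "'a::euclidean_space set \<Rightarrow> ('a \<Rightarrow> 'b::euclidean_space) \<Rightarrow> 'a \<Rightarrow> 'a \<Rightarrow> 'b" where
  "tangent_map M f p v =
     (THE w. \<forall>\<gamma>. curve_in M p v \<gamma> \<longrightarrow> ((f \<circ> \<gamma>) has_vector_derivative w) (at 0))"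


section \<open>Principal bundles and principal connections\<close>

definition matrix_lie_group :: "(real^'n^'n) set \<Rightarrow> bool" where
  "matrix_lie_group G \<longleftrightarrow>
     G \<subseteq> {A. invertible A} \<and> mat 1 \<in> G \<and>
     (\<forall>S\<in>G. \<forall>T\<in>G. S ** T \<in> G) \<and> (\<forall>S\<in>G. matrix_inv S \<in> G) \<and>
     closedin (top_of_set {A. invertible A}) G"

(* The group acts on the left, as in the diagonal action considered here.  Local triviality
   makes the action free, makes the fibres of \<pi> the orbits, and makes P a submanifold. *)
definition principal_bundle ::
  "(real^'n^'n) set \<Rightarrow> (real^'n^'n \<Rightarrow> 'p \<Rightarrow> 'p) \<Rightarrow>
   'p::euclidean_space set \<Rightarrow> ('p \<Rightarrow> 'b) \<Rightarrow> 'b::euclidean_space set \<Rightarrow> bool" where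
  "principal_bundle G act P \<pi> B \<longleftrightarrow>
     matrix_lie_group G \<and> (\<exists>k. submanifold k B) \<and>
     (\<forall>S\<in>G. \<forall>p\<in>P. act S p \<in> P) \<and>
     (\<forall>p\<in>P. act (mat 1) p = p) \<and>
     (\<forall>S\<in>G. \<forall>T\<in>G. \<forall>p\<in>P. act (S ** T) p = act S (act T p)) \<and>
     smooth_map (G \<times> P) (\<lambda>(S, p). act S p) \<and>
     smooth_map P \<pi> \<and> \<pi> ` P = B \<and>
     (\<forall>S\<in>G. \<forall>p\<in>P. \<pi> (act S p) = \<pi> p) \<and>
     (\<forall>b\<in>B. \<exists>U \<phi>. open U \<and> b \<in> U \<and>
        diffeo {p\<in>P. \<pi> p \<in> U} ((B \<inter> U) \<times> G) \<phi> \<and>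
        (\<forall>p\<in>P. \<pi> p \<in> U \<longrightarrow> fst (\<phi> p) = \<pi> p \<and>
           (\<forall>S\<in>G. \<phi> (act S p) = (\<pi> p, S ** snd (\<phi> p)))))"

definition vertical_space ::
  "'p::euclidean_space set \<Rightarrow> ('p \<Rightarrow> 'b::euclidean_space) \<Rightarrow> 'p \<Rightarrow> 'p set" where
  "vertical_space P \<pi> p = {v \<in> tangent_space P p. tangent_map P \<pi> p v = 0}"

(* Local smooth frames X 0, ..., X (k - 1). *)
definition smooth_distribution ::
  "'p::euclidean_space set \<Rightarrow> ('p \<Rightarrow> 'p set) \<Rightarrow> bool" where
  "smooth_distribution P H \<longleftrightarrow>
     (\<forall>p\<in>P. \<exists>U k (X :: nat \<Rightarrow> 'p \<Rightarrow> 'p). open U \<and> p \<in> U \<and>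
        (\<forall>i<k. smooth_map (P \<inter> U) (X i)) \<and>
        (\<forall>y\<in>P \<inter> U. H y = span ((\<lambda>i. X i y) ` {..<k}) \<and> dim (H y) = k))"

definition principal_connection ::
  "(real^'n^'n) set \<Rightarrow> (real^'n^'n \<Rightarrow> 'p \<Rightarrow> 'p) \<Rightarrow>
   'p::euclidean_space set \<Rightarrow> ('p \<Rightarrow> 'b::euclidean_space) \<Rightarrow> ('p \<Rightarrow> 'p set) \<Rightarrow> bool" where
  "principal_connection G act P \<pi> H \<longleftrightarrow>
     (\<forall>p\<in>P. subspace (H p) \<and> H p \<subseteq> tangent_space P p \<and>
        H p \<inter> vertical_space P \<pi> p = {0} \<and>
        (\<forall>u\<in>tangent_space P p. \<exists>h\<in>H p. \<exists>w\<in>vertical_space P \<pi> p. u = h + w)) \<and>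
     (\<forall>S\<in>G. \<forall>p\<in>P. H (act S p) = tangent_map P (act S) p ` H p) \<and>
     smooth_distribution P H"


section \<open>The rolling body\<close>

definition center_of_mass :: "(real^3) measure \<Rightarrow> real^3" where
  "center_of_mass \<mu> = (1 / measure \<mu> UNIV) *\<^sub>R (\<integral>y. y \<partial>\<mu>)"

definition inertia_tensor :: "(real^3) measure \<Rightarrow> real^3^3" where
  "inertia_tensor \<mu> =
     (\<chi> i j. \<integral>y. (if i = j then (norm y)\<^sup>2 else 0) - y $ i * y $ j \<partial>\<mu>)"

definition standard_position :: "(real^3) measure \<Rightarrow> bool" where
  "standard_position \<mu> \<longleftrightarrow>
     center_of_mass \<mu> = 0 \<and>
     (\<forall>i. \<exists>c. inertia_tensor \<mu> *v axis i 1 = c *\<^sub>R axis i 1)"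

(* \<mu> is the mass distribution.  The region B bounded by \<Sigma> need not be bounded: a body with a
   cavity that rolls around a sphere lying inside the cavity occupies part of the exterior
   region of \<Sigma>. *)
definition rigid_body ::
  "(real^3) set \<Rightarrow> (real^3) measure \<Rightarrow> (real^3) set \<Rightarrow> bool" where
  "rigid_body B \<mu> \<Sigma> \<longleftrightarrow>
     closed B \<and> closure (interior B) = B \<and> frontier B = \<Sigma> \<and> submanifold 2 \<Sigma> \<and>
     sets \<mu> = sets borel \<and> finite_measure \<mu> \<and> 0 < measure \<mu> UNIV \<and>
     emeasure \<mu> (- B) = 0 \<and> integrable \<mu> (\<lambda>y. (norm y)\<^sup>2)"

(* Both orientations are allowed: the exterior normal gives external rolling, the interior
   one internal rolling. *)
definition gauss_map :: "(real^3) set \<Rightarrow> (real^3 \<Rightarrow> real^3) \<Rightarrow> bool" where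
  "gauss_map \<Sigma> N \<longleftrightarrow>
     smooth_map \<Sigma> N \<and>
     (\<forall>p\<in>\<Sigma>. norm (N p) = 1 \<and> (\<forall>v\<in>tangent_space \<Sigma> p. N p \<bullet> v = 0))"


section \<open>Euclidean motions\<close>

definition SO3 :: "(real^3^3) set" where
  "SO3 = {R. rotation_matrix R}"

(* (R, x) stands for: rotate by R, then translate by x. *)
type_synonym motion = "(real^3^3) \<times> (real^3)"

definition move :: "motion \<Rightarrow> real^3 \<Rightarrow> real^3" where
  "move g y = fst g *v y + snd g"

definition motion_comp :: "motion \<Rightarrow> motion \<Rightarrow> motion" where
  "motion_comp h g = (fst h ** fst g, fst h *v snd g + snd h)"

definition rotation_motion :: "real^3^3 \<Rightarrow> motion" where
  "rotation_motion S = (S, 0)"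

(* The Gauss map of the displaced surface move g ` \<Sigma>, with the orientation carried along. *)
definition displaced_gauss :: "motion \<Rightarrow> (real^3 \<Rightarrow> real^3) \<Rightarrow> real^3 \<Rightarrow> real^3" where
  "displaced_gauss g N y = fst g *v N (matrix_inv (fst g) *v (y - snd g))"

definition dN_displaced ::
  "(real^3) set \<Rightarrow> (real^3 \<Rightarrow> real^3) \<Rightarrow> motion \<Rightarrow> real^3 \<Rightarrow> real^3 \<Rightarrow> real^3" where
  "dN_displaced \<Sigma> N g q v = tangent_map (move g ` \<Sigma>) (displaced_gauss g N) q v"

definition cross_mat :: "real^3 \<Rightarrow> real^3^3" where
  "cross_mat \<omega> = matrix (\<lambda>v. cross3 \<omega> v)"

definition angular_velocity :: "real^3^3 \<Rightarrow> real^3^3 \<Rightarrow> real^3 \<Rightarrow> bool" where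
  "angular_velocity R R' \<omega> \<longleftrightarrow> R' ** matrix_inv R = cross_mat \<omega>"


section \<open>Rolling on the sphere of radius a\<close>

type_synonym config = "(real^3) \<times> (real^3^3)"

definition config_space :: "real \<Rightarrow> config set" where
  "config_space a = sphere 0 a \<times> SO3"

definition diag_action :: "real^3^3 \<Rightarrow> config \<Rightarrow> config" where
  "diag_action S = (\<lambda>(q, R). (S *v q, S ** R))"

definition bundle_proj :: "real \<Rightarrow> config \<Rightarrow> real^3" where
  "bundle_proj a = (\<lambda>(q, R). (1 / a) *\<^sub>R (matrix_inv R *v q))"

definition N1 :: "real \<Rightarrow> real^3 \<Rightarrow> real^3" where
  "N1 a q = (1 / a) *\<^sub>R q"

definition contact_on_body ::
  "real \<Rightarrow> (real^3) set \<Rightarrow> (real^3 \<Rightarrow> real^3) \<Rightarrow> config \<Rightarrow> real^3" where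
  "contact_on_body a \<Sigma> N = (\<lambda>(q, R). inv_into \<Sigma> N (- (matrix_inv R *v N1 a q)))"

definition body_center ::
  "real \<Rightarrow> (real^3) set \<Rightarrow> (real^3 \<Rightarrow> real^3) \<Rightarrow> config \<Rightarrow> real^3" where
  "body_center a \<Sigma> N = (\<lambda>(q, R). q - R *v contact_on_body a \<Sigma> N (q, R))"

definition body_motion ::
  "real \<Rightarrow> (real^3) set \<Rightarrow> (real^3 \<Rightarrow> real^3) \<Rightarrow> config \<Rightarrow> motion" where
  "body_motion a \<Sigma> N p = (snd p, body_center a \<Sigma> N p)"

(* u is a tangent vector of the configuration space at p; the left-hand side is the velocity
   of the centre of mass along any motion through p with velocity u. *)
definition no_slip ::
  "real \<Rightarrow> (real^3) set \<Rightarrow> (real^3 \<Rightarrow> real^3) \<Rightarrow> config \<Rightarrow> config \<Rightarrow> real^3 \<Rightarrow> bool" where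
  "no_slip a \<Sigma> N p u \<omega> \<longleftrightarrow>
     tangent_map (config_space a) (body_center a \<Sigma> N) p u =
       cross3 \<omega> (body_center a \<Sigma> N p - fst p)"

definition no_twist :: "real \<Rightarrow> config \<Rightarrow> real^3 \<Rightarrow> bool" where
  "no_twist a p \<omega> \<longleftrightarrow> \<omega> \<bullet> N1 a (fst p) = 0"

definition rolling_distribution ::
  "real \<Rightarrow> (real^3) set \<Rightarrow> (real^3 \<Rightarrow> real^3) \<Rightarrow> config \<Rightarrow> config set" where
  "rolling_distribution a \<Sigma> N p =
     {u \<in> tangent_space (config_space a) p.
        \<exists>\<omega>. angular_velocity (snd p) (snd u) \<omega> \<and> no_slip a \<Sigma> N p u \<omega> \<and> no_twist a p \<omega>}"

end

theory Submission
  imports Defs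
begin

text \<open>
Write \<open>\<psi>\<close> for the inverse of the Gauss map \<open>N\<close> of the body and \<open>u = - (1 / a) *\<^sub>R (transpose R *v q)\<close>
for the normal of the body at the contact point, in the body frame. The centre of mass is then
\<open>q - R *v \<psi> u\<close>. Differentiating this along a motion with angular velocity \<open>\<omega>\<close>, the terms with
\<open>\<psi> u\<close> cancel in the no-slip condition, and what remains is that \<open>transpose R *v q'\<close> is the image of
\<open>u' = (1 / a) *\<^sub>R (transpose R *v (cross3 \<omega> q - q'))\<close> under the differential of \<open>\<psi>\<close> at \<open>u\<close>.

Since \<open>N \<circ> \<psi>\<close> is the identity and the tangent plane of the surface at \<open>\<psi> u\<close> is orthogonal to \<open>u\<close>, the
differentials of \<open>\<psi>\<close> and \<open>N\<close> are mutually inverse automorphisms of the plane orthogonal to \<open>u\<close>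
(lemmas \<open>dN_d\<psi>\<close> and \<open>d\<psi>_dN\<close>). Conjugating by \<open>R\<close> turns the no-slip condition into
\<open>cross3 \<omega> q = q' + a *\<^sub>R dN q'\<close> with the Gauss map of the displaced body (lemma \<open>no_slip_iff\<close>), and
together with \<open>\<omega> \<bullet> q = 0\<close> this has exactly one solution \<open>\<omega>\<close> (lemma \<open>constraints_iff\<close>). Rotating the
whole configuration conjugates everything by the rotation, whence the equivariance.

For the connection it is best to parametrise the horizontal vectors by the velocity \<open>w\<close> of \<open>u\<close>
instead of \<open>q'\<close>. Because the projection of the bundle is \<open>- u\<close>, its differential maps the
horizontal vector with parameter \<open>w\<close> to \<open>- w\<close> (lemma \<open>tangent_bundle_proj_lift\<close>): the horizontal
space is a complement of the vertical one, and it depends smoothly on the configuration because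
the differential of \<open>\<psi>\<close> does. The bundle itself is trivial, since \<open>(q, R)\<close> is determined by its
projection and \<open>R\<close>.
\<close>

section \<open>Calculus of smooth maps\<close>

text \<open>Derivatives at interior points see only germs, so openness of the domain makes the
higher-order predicate insensitive to values elsewhere.\<close>

lemma Ck_on_cong:
  assumes "open U" "\<And>x. x \<in> U \<Longrightarrow> f x = g x"
  shows "Ck_on k U f \<longleftrightarrow> Ck_on k U g"
  using assms(2)
proof (induction k arbitrary: f g)
  case 0
  then show ?case by (simp cong: continuous_on_cong)
next
  case (Suc k)
  have d: "(f has_derivative D) (at x) \<longleftrightarrow> (g has_derivative D) (at x)" if "x \<in> U" for x D
    using has_derivative_transform_within_open[of _ D x UNIV U] assms(1) that Suc.prems by metis
  have "frechet_derivative f (at x) = frechet_derivative g (at x)" if "x \<in> U" for x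
    unfolding frechet_derivative_def d[OF that] ..
  then have "Ck_on k U (\<lambda>x. frechet_derivative f (at x) v) = Ck_on k U (\<lambda>x. frechet_derivative g (at x) v)" for v
    by (intro Suc.IH) simp
  with d show ?case by (auto simp: differentiable_def)
qed

lemma Ck_on_SucI:
  assumes "open U" "\<And>x. x \<in> U \<Longrightarrow> (f has_derivative f' x) (at x)"
    and "\<And>v. Ck_on k U (\<lambda>x. f' x v)"
  shows "Ck_on (Suc k) U f"
proof -
  have "Ck_on k U (\<lambda>x. frechet_derivative f (at x) v) \<longleftrightarrow> Ck_on k U (\<lambda>x. f' x v)" for v
    by (intro Ck_on_cong assms(1)) (metis assms(2) frechet_derivative_at)
  with assms(2,3) show ?thesis by (auto simp: differentiable_def)
qed

lemma Ck_on_SucD: "Ck_on (Suc k) U f \<Longrightarrow> Ck_on k U f"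
proof (induction k arbitrary: f)
  case 0
  then show ?case
    by (auto intro!: continuous_at_imp_continuous_on differentiable_imp_continuous_within)
next
  case (Suc k)
  then show ?case by (metis Ck_on.simps(2))
qed

lemma Ck_on_subset: "Ck_on k U f \<Longrightarrow> V \<subseteq> U \<Longrightarrow> Ck_on k V f"
  by (induction k arbitrary: f) (auto intro: continuous_on_subset)

lemma Ck_on_const: "Ck_on k U (\<lambda>x. c)"
  by (induction k arbitrary: c) auto

lemma Ck_on_ident: "Ck_on k U (\<lambda>x. x)"
  by (cases k) (auto simp: Ck_on_const)

lemma Ck_on_add:
  assumes "open U" "Ck_on k U f" "Ck_on k U g"
  shows "Ck_on k U (\<lambda>x. f x + g x)"
  using assms(2,3)
proof (induction k arbitrary: f g)
  case 0
  then show ?case by (simp add: continuous_on_add)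
next
  case (Suc k)
  show ?case
    by (rule Ck_on_SucI[OF assms(1),
          where f' = "\<lambda>x v. frechet_derivative f (at x) v + frechet_derivative g (at x) v"])
       (use Suc in \<open>auto intro!: has_derivative_add simp: frechet_derivative_works[symmetric]\<close>)
qed

lemma Ck_on_linear:
  assumes "open U" "bounded_linear h" "Ck_on k U f"
  shows "Ck_on k U (\<lambda>x. h (f x))"
  using assms(3)
proof (induction k arbitrary: f)
  case 0
  then show ?case by (simp add: bounded_linear.continuous_on[OF assms(2)])
next
  case (Suc k)
  show ?case
    by (rule Ck_on_SucI[OF assms(1), where f' = "\<lambda>x v. h (frechet_derivative f (at x) v)"])
       (use Suc in \<open>auto intro!: bounded_linear.has_derivative[OF assms(2)] simp: frechet_derivative_works[symmetric]\<close>)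
qed

lemma Ck_on_bilinear:
  assumes "open U" "bounded_bilinear h" "Ck_on k U f" "Ck_on k U g"
  shows "Ck_on k U (\<lambda>x. h (f x) (g x))"
  using assms(3,4)
proof (induction k arbitrary: f g)
  case 0
  then show ?case by (simp add: bounded_bilinear.continuous_on[OF assms(2)])
next
  case (Suc k)
  have fg: "Ck_on k U f" "Ck_on k U g"
    using Suc.prems by (simp_all add: Ck_on_SucD del: Ck_on.simps)
  show ?case
  proof (rule Ck_on_SucI[OF assms(1)])
    show "((\<lambda>x. h (f x) (g x)) has_derivative
           (\<lambda>v. h (f x) (frechet_derivative g (at x) v) + h (frechet_derivative f (at x) v) (g x))) (at x)"
      if "x \<in> U" for x
      using that Suc.prems
      by (intro bounded_bilinear.FDERIV[OF assms(2)]) (auto simp: frechet_derivative_works[symmetric])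
    show "Ck_on k U (\<lambda>x. h (f x) (frechet_derivative g (at x) v) + h (frechet_derivative f (at x) v) (g x))" for v
      using Suc.prems fg by (intro Ck_on_add[OF assms(1)] Suc.IH) auto
  qed
qed

lemma Ck_on_sum:
  assumes "open U" "\<And>i. i \<in> I \<Longrightarrow> Ck_on k U (f i)"
  shows "Ck_on k U (\<lambda>x. \<Sum>i\<in>I. f i x)"
  using assms(2)
  by (induction I rule: infinite_finite_induct) (auto intro: Ck_on_const Ck_on_add[OF assms(1)])

lemma linear_Basis_expand:
  fixes f :: "'a::euclidean_space \<Rightarrow> 'b::real_vector"
  assumes "linear f"
  shows "f v = (\<Sum>b\<in>Basis. (v \<bullet> b) *\<^sub>R f b)"
proof -
  have "f v = f (\<Sum>b\<in>Basis. (v \<bullet> b) *\<^sub>R b)"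
    by (simp add: euclidean_representation)
  also have "\<dots> = (\<Sum>b\<in>Basis. (v \<bullet> b) *\<^sub>R f b)"
    using assms by (simp add: linear_sum linear_cmul)
  finally show ?thesis .
qed

text \<open>The chain rule writes the derivative of the composite as a finite sum of products of
partial derivatives of the outer map, composed with the inner one, and of coordinates of the
derivative of the inner map. The induction on the order therefore needs the claim for all outer maps.\<close>

lemma Ck_on_compose:
  fixes g :: "'a::real_normed_vector \<Rightarrow> 'b::euclidean_space"
  assumes "open U" "open V" "g ` U \<subseteq> V" "Ck_on k V f" "Ck_on k U g"
  shows "Ck_on k U (\<lambda>x. f (g x))"
  using assms(4,5)
proof (induction k arbitrary: f)
  case 0
  then show ?case using assms(3) continuous_on_compose2 by fastforce
next
  case (Suc k)
  have gk: "Ck_on k U g"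
    using Suc.prems by (simp add: Ck_on_SucD del: Ck_on.simps)
  let ?Dg = "\<lambda>x v. frechet_derivative g (at x) v" and ?Df = "\<lambda>b y. frechet_derivative f (at y) b"
  show ?case
  proof (rule Ck_on_SucI[OF assms(1)])
    fix x assume x: "x \<in> U"
    then have fd: "f differentiable at (g x)" and gd: "g differentiable at x"
      using Suc.prems assms(3) by auto
    have "((f \<circ> g) has_derivative (frechet_derivative f (at (g x)) \<circ> frechet_derivative g (at x))) (at x)"
      by (intro diff_chain_at) (use fd gd in \<open>simp_all add: frechet_derivative_works[symmetric]\<close>)
    moreover have "frechet_derivative f (at (g x)) \<circ> frechet_derivative g (at x)
        = (\<lambda>v. \<Sum>b\<in>Basis. (?Dg x v \<bullet> b) *\<^sub>R ?Df b (g x))"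
      unfolding o_def by (intro ext linear_Basis_expand linear_frechet_derivative fd)
    ultimately show "((\<lambda>x. f (g x)) has_derivative (\<lambda>v. \<Sum>b\<in>Basis. (?Dg x v \<bullet> b) *\<^sub>R ?Df b (g x))) (at x)"
      by (simp add: o_def)
  next
    fix v
    show "Ck_on k U (\<lambda>x. \<Sum>b\<in>Basis. (?Dg x v \<bullet> b) *\<^sub>R ?Df b (g x))"
    proof (intro Ck_on_sum assms(1) Ck_on_bilinear[OF _ bounded_bilinear_scaleR])
      fix b :: 'b
      show "Ck_on k U (\<lambda>x. ?Dg x v \<bullet> b)"
        using Suc.prems by (intro Ck_on_linear[OF assms(1) bounded_linear_inner_left]) auto
      show "Ck_on k U (\<lambda>x. ?Df b (g x))"
        using Suc.prems gk by (intro Suc.IH) auto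
    qed
  qed
qed

lemma Ck_on_inverse: "Ck_on k (- {0}) (inverse :: real \<Rightarrow> real)"
proof (induction k)
  case 0
  then show ?case by (auto intro: continuous_intros)
next
  case (Suc k)
  have o: "open (- {0::real})" by (simp add: open_Compl)
  show ?case
  proof (rule Ck_on_SucI[OF o])
    show "(inverse has_derivative (\<lambda>v. - (v * (inverse x * inverse x)))) (at x)" if "x \<in> - {0}" for x :: real
      using that by (auto intro!: derivative_eq_intros simp: ac_simps)
    show "Ck_on k (- {0}) (\<lambda>x. - (v * (inverse x * inverse x)))" for v :: real
      by (intro Ck_on_linear[OF o bounded_linear_minus[OF bounded_linear_ident]] Ck_on_bilinear[OF o bounded_bilinear_mult]
          Ck_on_const Suc)
  qed
qed

lemma smooth_cong:
  "open U \<Longrightarrow> (\<And>x. x \<in> U \<Longrightarrow> f x = g x) \<Longrightarrow> smooth_on_open U f \<longleftrightarrow> smooth_on_open U g"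
  unfolding smooth_on_open_def using Ck_on_cong by blast

lemma smooth_subset: "smooth_on_open U f \<Longrightarrow> V \<subseteq> U \<Longrightarrow> smooth_on_open V f"
  unfolding smooth_on_open_def using Ck_on_subset by blast

lemma smooth_const: "smooth_on_open U (\<lambda>x. c)"
  and smooth_ident: "smooth_on_open U (\<lambda>x. x)"
  unfolding smooth_on_open_def by (auto intro: Ck_on_const Ck_on_ident)

lemma smooth_add: "open U \<Longrightarrow> smooth_on_open U f \<Longrightarrow> smooth_on_open U g \<Longrightarrow> smooth_on_open U (\<lambda>x. f x + g x)"
  unfolding smooth_on_open_def using Ck_on_add by blast

lemma smooth_sum:
  "open U \<Longrightarrow> (\<And>i. i \<in> I \<Longrightarrow> smooth_on_open U (f i)) \<Longrightarrow> smooth_on_open U (\<lambda>x. \<Sum>i\<in>I. f i x)"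
  unfolding smooth_on_open_def by (auto intro!: Ck_on_sum)

lemma smooth_linear:
  "open U \<Longrightarrow> bounded_linear h \<Longrightarrow> smooth_on_open U f \<Longrightarrow> smooth_on_open U (\<lambda>x. h (f x))"
  unfolding smooth_on_open_def using Ck_on_linear by blast

lemma smooth_bilinear:
  "open U \<Longrightarrow> bounded_bilinear h \<Longrightarrow> smooth_on_open U f \<Longrightarrow> smooth_on_open U g
   \<Longrightarrow> smooth_on_open U (\<lambda>x. h (f x) (g x))"
  unfolding smooth_on_open_def using Ck_on_bilinear by blast

lemma smooth_compose:
  fixes g :: "'a::real_normed_vector \<Rightarrow> 'b::euclidean_space"
  assumes "open U" "open V" "g ` U \<subseteq> V" "smooth_on_open V f" "smooth_on_open U g"
  shows "smooth_on_open U (\<lambda>x. f (g x))"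
  using assms unfolding smooth_on_open_def by (auto intro: Ck_on_compose)

lemma smooth_inverse:
  fixes f :: "'a::real_normed_vector \<Rightarrow> real"
  assumes "open U" "smooth_on_open U f" "\<And>x. x \<in> U \<Longrightarrow> f x \<noteq> 0"
  shows "smooth_on_open U (\<lambda>x. inverse (f x))"
  by (rule smooth_compose[where V = "- {0}"])
     (use assms in \<open>auto simp: smooth_on_open_def intro: Ck_on_inverse\<close>)

lemma smooth_minus: "open U \<Longrightarrow> smooth_on_open U f \<Longrightarrow> smooth_on_open U (\<lambda>x. - f x)"
  by (rule smooth_linear[OF _ bounded_linear_minus[OF bounded_linear_ident]])

lemma smooth_Pair:
  assumes "open U" "smooth_on_open U f" "smooth_on_open U g"
  shows "smooth_on_open U (\<lambda>x. (f x :: 'b::real_normed_vector, g x :: 'c::real_normed_vector))"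
proof -
  have "bounded_linear (\<lambda>x::'b. (x, 0::'c))" "bounded_linear (\<lambda>y::'c. (0::'b, y))"
    by (simp_all add: bounded_linear_Pair)
  from smooth_add[OF assms(1) smooth_linear[OF assms(1) this(1) assms(2)] smooth_linear[OF assms(1) this(2) assms(3)]]
  have "smooth_on_open U (\<lambda>x. (f x, 0) + (0, g x))" .
  then show ?thesis by simp
qed

lemma smooth_imp_continuous: "smooth_on_open U f \<Longrightarrow> continuous_on U f"
  unfolding smooth_on_open_def using Ck_on.simps(1) by blast

lemma smooth_imp_derivative:
  "smooth_on_open U f \<Longrightarrow> x \<in> U \<Longrightarrow> (f has_derivative frechet_derivative f (at x)) (at x)"
  unfolding smooth_on_open_def frechet_derivative_works[symmetric]
  by (drule spec[of _ "Suc 0"]) simp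

lemma smooth_frechet_derivative:
  "smooth_on_open U f \<Longrightarrow> smooth_on_open U (\<lambda>x. frechet_derivative f (at x) v)"
  unfolding smooth_on_open_def
proof
  fix k assume "\<forall>k. Ck_on k U f"
  then have "Ck_on (Suc k) U f" by blast
  then show "Ck_on k U (\<lambda>x. frechet_derivative f (at x) v)" by simp
qed

text \<open>Joint smoothness in base point and direction: by linearity the derivative is a combination
of its values on basis vectors, which are smooth by definition. This makes the frame of the
rolling distribution smooth.\<close>

lemma smooth_frechet_derivative_compose:
  fixes u :: "'a::real_normed_vector \<Rightarrow> 'b::euclidean_space"
  assumes "open U" "open V" "u ` U \<subseteq> V" "smooth_on_open V f"
    "smooth_on_open U u" "smooth_on_open U w"
  shows "smooth_on_open U (\<lambda>x. frechet_derivative f (at (u x)) (w x))"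
proof -
  have "smooth_on_open U (\<lambda>x. \<Sum>b\<in>Basis. (w x \<bullet> b) *\<^sub>R frechet_derivative f (at (u x)) b)"
    by (intro smooth_sum assms(1) smooth_bilinear[OF _ bounded_bilinear_scaleR]
        smooth_linear[OF _ bounded_linear_inner_left] assms(6)
        smooth_compose[OF assms(1,2,3) smooth_frechet_derivative[OF assms(4)] assms(5)])
  moreover have "frechet_derivative f (at (u x)) (w x) = (\<Sum>b\<in>Basis. (w x \<bullet> b) *\<^sub>R frechet_derivative f (at (u x)) b)"
    if "x \<in> U" for x
  proof -
    have "linear (frechet_derivative f (at (u x)))"
      using smooth_imp_derivative[OF assms(4), of "u x"] assms(3) that
      by (auto intro: has_derivative_linear)
    then show ?thesis by (rule linear_Basis_expand)
  qed
  ultimately show ?thesis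
    using smooth_cong[OF assms(1)] by (metis (no_types, lifting))
qed

lemma bounded_bilinear_matrix_vector_mult: "bounded_bilinear ((*v) :: real^'n^'m \<Rightarrow> _)"
  by (auto simp: bilinear_conv_bounded_bilinear[symmetric] bilinear_def linear_iff
      matrix_vector_right_distrib matrix_vector_mult_add_rdistrib matrix_vector_mult_scaleR scaleR_matrix_vector_assoc)

lemma bounded_bilinear_matrix_matrix_mult: "bounded_bilinear ((**) :: real^'n^'m \<Rightarrow> real^'k^'n \<Rightarrow> _)"
  by (auto simp: bilinear_conv_bounded_bilinear[symmetric] bilinear_def linear_iff
      matrix_matrix_mult_def vec_eq_iff algebra_simps sum.distrib sum_distrib_left)

lemma bounded_bilinear_cross3: "bounded_bilinear cross3"
  using bilinear_cross bilinear_conv_bounded_bilinear by blast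

lemma bounded_linear_transpose: "bounded_linear (transpose :: real^'n^'m \<Rightarrow> _)"
  by (auto simp: linear_conv_bounded_linear[symmetric] linear_iff transpose_def vec_eq_iff)

lemma bounded_linear_cross_mat: "bounded_linear cross_mat"
  by (auto simp: linear_conv_bounded_linear[symmetric] linear_iff cross_mat_def matrix_def vec_eq_iff
      cross_add_left cross_mult_left)

text \<open>All concrete maps below are polynomial in their arguments, or rational with an explicit
denominator, once the inverse of a rotation is written as its transpose; these rules cover them.\<close>

lemmas smooth_intros = smooth_const smooth_ident smooth_add smooth_minus smooth_Pair
  smooth_bilinear[OF _ bounded_bilinear_mult]
  smooth_bilinear[OF _ bounded_bilinear_scaleR]
  smooth_bilinear[OF _ bounded_bilinear_inner]
  smooth_bilinear[OF _ bounded_bilinear_matrix_vector_mult]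
  smooth_bilinear[OF _ bounded_bilinear_matrix_matrix_mult]
  smooth_bilinear[OF _ bounded_bilinear_cross3]
  smooth_linear[OF _ bounded_linear_transpose]
  smooth_linear[OF _ bounded_linear_cross_mat]
  smooth_linear[OF _ bounded_linear_fst] smooth_linear[OF _ bounded_linear_snd]
  smooth_inverse


section \<open>Curves and differentials\<close>

lemma smooth_mapI:
  assumes "open U" "M \<subseteq> U" "smooth_on_open U F" "\<And>x. x \<in> M \<Longrightarrow> F x = f x"
  shows "smooth_map M f"
  unfolding smooth_map_def using assms by blast

lemma smooth_map_cong:
  assumes "\<And>x. x \<in> M \<Longrightarrow> f x = g x"
  shows "smooth_map M f \<longleftrightarrow> smooth_map M g"
  unfolding smooth_map_def using assms by (intro ball_cong refl arg_cong[where f = Ex] ext conj_cong) auto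

lemma smooth_mapE:
  assumes "smooth_map M f" "p \<in> M"
  obtains U F where "open U" "p \<in> U" "smooth_on_open U F" "\<And>x. x \<in> M \<inter> U \<Longrightarrow> F x = f x"
proof -
  from assms have "\<exists>U F. open U \<and> p \<in> U \<and> smooth_on_open U F \<and> (\<forall>x\<in>M \<inter> U. F x = f x)"
    unfolding smooth_map_def by (rule bspec)
  then obtain U F where "open U" "p \<in> U" "smooth_on_open U F" "\<forall>x\<in>M \<inter> U. F x = f x"
    by (elim exE conjE)
  then show thesis by (intro that[of U F]) auto
qed

lemma diffeoI:
  assumes "smooth_map M f" "smooth_map M' g" "f ` M \<subseteq> M'" "g ` M' \<subseteq> M"
    and "\<And>x. x \<in> M \<Longrightarrow> g (f x) = x" "\<And>y. y \<in> M' \<Longrightarrow> f (g y) = y"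
  shows "diffeo M M' f"
proof -
  have bij: "bij_betw f M M'"
    using assms by (intro bij_betw_byWitness[where f' = g]) auto
  have "inv_into M f y = g y" if "y \<in> M'" for y
    using bij_betw_imp_inj_on[OF bij] assms(4,6) that by (intro inv_into_f_eq) auto
  then have "smooth_map M' (inv_into M f)"
    using assms(2) smooth_map_cong by metis
  with bij assms(1) show ?thesis by (simp add: diffeo_def)
qed

lemma curve_in_mem: "curve_in M p v \<gamma> \<Longrightarrow> p \<in> M"
  unfolding curve_in_def by fastforce

lemma has_vector_derivative_chain_at:
  assumes "(\<gamma> has_vector_derivative v) (at t)" "(F has_derivative D) (at (\<gamma> t))"
  shows "((F \<circ> \<gamma>) has_vector_derivative D v) (at t)"
  using diff_chain_at[OF assms(1)[unfolded has_vector_derivative_def] assms(2)]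
    linear_cmul[OF has_derivative_linear[OF assms(2)]]
  by (simp add: has_vector_derivative_def o_def)

lemma has_vector_derivative_near:
  assumes "(g has_vector_derivative v) (at (t::real))" "open A" "t \<in> A" "\<And>s. s \<in> A \<Longrightarrow> g s = f s"
  shows "(f has_vector_derivative v) (at t)"
  using assms has_vector_derivative_transform_within_open by blast

text \<open>Smoothness of a map on a subset is only known through local extensions; a curve stays in the
domain of the extension for a short time, which suffices because curves need to be smooth only
near time zero.\<close>

lemma curve_in_extension:
  fixes f :: "'a::euclidean_space \<Rightarrow> 'b::euclidean_space"
  assumes U: "open U" "p \<in> U" "smooth_on_open U F" "\<And>x. x \<in> M \<inter> U \<Longrightarrow> F x = f x"
    and \<gamma>: "curve_in M p v \<gamma>" and f: "f ` M \<subseteq> M'"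
  shows "curve_in M' (f p) (frechet_derivative F (at p) v) (f \<circ> \<gamma>)"
proof -
  obtain e where e: "e > 0" "smooth_on_open {-e<..<e} \<gamma>" "\<gamma> ` {-e<..<e} \<subseteq> M"
    and \<gamma>0: "\<gamma> 0 = p" and d: "(\<gamma> has_vector_derivative v) (at 0)"
    using \<gamma> unfolding curve_in_def by blast
  have "isCont \<gamma> 0" using d by (rule has_vector_derivative_continuous)
  then obtain e1 where e1: "e1 > 0" "\<And>t. \<bar>t\<bar> < e1 \<Longrightarrow> \<gamma> t \<in> U"
  proof -
    obtain A where "open A" "0 \<in> A" "\<forall>t\<in>A. \<gamma> t \<in> U"
      using \<open>isCont \<gamma> 0\<close> U(1,2) \<gamma>0 unfolding continuous_at_open by metis
    moreover from this obtain e1 where "e1 > 0" "ball 0 e1 \<subseteq> A" using open_contains_ball by metis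
    ultimately show thesis by (intro that[of e1]) (auto simp: subset_iff)
  qed
  define r where "r = min e e1"
  have r: "r > 0" "{-r<..<r} \<subseteq> {-e<..<e}" "\<gamma> ` {-r<..<r} \<subseteq> U" "\<gamma> ` {-r<..<r} \<subseteq> M"
    using e e1 unfolding r_def by (auto simp: image_subset_iff)
  have eq: "F (\<gamma> t) = (f \<circ> \<gamma>) t" if "t \<in> {-r<..<r}" for t
    using r(3,4) that U(4) by (auto simp: image_subset_iff)
  have "smooth_on_open {-r<..<r} (\<lambda>t. F (\<gamma> t))"
    using r by (intro smooth_compose[OF _ U(1) _ U(3)] smooth_subset[OF e(2)]) auto
  then have "smooth_on_open {-r<..<r} (f \<circ> \<gamma>)"
    by (subst smooth_cong[where g = "\<lambda>t. F (\<gamma> t)"]) (use eq in auto)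
  moreover have "((f \<circ> \<gamma>) has_vector_derivative frechet_derivative F (at p) v) (at 0)"
  proof (rule has_vector_derivative_near[where A = "{-r<..<r}"])
    show "((F \<circ> \<gamma>) has_vector_derivative frechet_derivative F (at p) v) (at 0)"
      using smooth_imp_derivative[OF U(3,2)] d \<gamma>0 by (intro has_vector_derivative_chain_at) auto
  qed (use r eq in auto)
  ultimately show ?thesis
    unfolding curve_in_def using r(1,4) f \<gamma>0 by (auto simp: image_subset_iff)
qed

lemma tangent_map_eqI:
  assumes "v \<in> tangent_space M p"
    and "\<And>\<gamma>. curve_in M p v \<gamma> \<Longrightarrow> ((f \<circ> \<gamma>) has_vector_derivative w) (at 0)"
  shows "tangent_map M f p v = w"
  unfolding tangent_map_def
proof (rule the_equality)
  obtain \<gamma> where "curve_in M p v \<gamma>" using assms(1) unfolding tangent_space_def by blast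
  then show "w' = w" if "\<forall>\<gamma>. curve_in M p v \<gamma> \<longrightarrow> ((f \<circ> \<gamma>) has_vector_derivative w') (at 0)" for w'
    using that assms(2) vector_derivative_unique_at by blast
qed (use assms(2) in blast)

lemma tangent_map_extension:
  fixes f :: "'a::euclidean_space \<Rightarrow> 'b::euclidean_space"
  assumes "open U" "p \<in> U" "smooth_on_open U F" "\<And>x. x \<in> M \<inter> U \<Longrightarrow> F x = f x"
    and "v \<in> tangent_space M p"
  shows "tangent_map M f p v = frechet_derivative F (at p) v"
  by (rule tangent_map_eqI[OF assms(5)])
     (use curve_in_extension[OF assms(1-4), where M' = UNIV] in \<open>auto simp: curve_in_def\<close>)

lemma curve_in_compose:
  fixes f :: "'a::euclidean_space \<Rightarrow> 'b::euclidean_space"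
  assumes f: "smooth_map M f" "f ` M \<subseteq> M'" and \<gamma>: "curve_in M p v \<gamma>"
  shows "curve_in M' (f p) (tangent_map M f p v) (f \<circ> \<gamma>)"
proof -
  obtain U F where U: "open U" "p \<in> U" "smooth_on_open U F" "\<And>x. x \<in> M \<inter> U \<Longrightarrow> F x = f x"
    using smooth_mapE[OF f(1) curve_in_mem[OF \<gamma>]] by metis
  have "v \<in> tangent_space M p" using \<gamma> unfolding tangent_space_def by blast
  from curve_in_extension[OF U \<gamma> f(2)] tangent_map_extension[OF U this] show ?thesis by simp
qed

lemma smooth_map_has_derivative_along:
  fixes f :: "'a::euclidean_space \<Rightarrow> 'b::euclidean_space"
  assumes "smooth_map M f" "curve_in M p v \<gamma>"
  shows "((f \<circ> \<gamma>) has_vector_derivative tangent_map M f p v) (at 0)"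
  using curve_in_compose[OF assms(1) subset_UNIV assms(2)] unfolding curve_in_def by blast

lemma tangent_map_in_tangent_space:
  fixes f :: "'a::euclidean_space \<Rightarrow> 'b::euclidean_space"
  assumes "smooth_map M f" "f ` M \<subseteq> M'" "v \<in> tangent_space M p"
  shows "tangent_map M f p v \<in> tangent_space M' (f p)"
  using assms curve_in_compose[OF assms(1,2)] unfolding tangent_space_def by blast

lemma tangent_map_linear_on:
  fixes f :: "'a::euclidean_space \<Rightarrow> 'b::euclidean_space"
  assumes "smooth_map M f" "p \<in> M"
  obtains D where "linear D" "\<And>v. v \<in> tangent_space M p \<Longrightarrow> tangent_map M f p v = D v"
proof -
  obtain U F where U: "open U" "p \<in> U" "smooth_on_open U F" "\<And>x. x \<in> M \<inter> U \<Longrightarrow> F x = f x"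
    using smooth_mapE[OF assms] by metis
  show thesis
    by (rule that[OF has_derivative_linear[OF smooth_imp_derivative[OF U(3,2)]]])
       (rule tangent_map_extension[OF U])
qed

text \<open>One extension that is differentiable at the single point determines the differential, so an
explicitly computed derivative can be used directly.\<close>

lemma tangent_map_has_derivative:
  fixes f :: "'a::euclidean_space \<Rightarrow> 'b::euclidean_space"
  assumes "(F has_derivative D) (at p)" "\<And>x. x \<in> M \<Longrightarrow> F x = f x" "v \<in> tangent_space M p"
  shows "tangent_map M f p v = D v"
proof (rule tangent_map_eqI[OF assms(3)])
  fix \<gamma> assume "curve_in M p v \<gamma>"
  then obtain e where e: "e > 0" "\<gamma> ` {-e<..<e} \<subseteq> M" "\<gamma> 0 = p" "(\<gamma> has_vector_derivative v) (at 0)"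
    unfolding curve_in_def by blast
  have "((F \<circ> \<gamma>) has_vector_derivative D v) (at 0)"
    using assms(1) e by (intro has_vector_derivative_chain_at) auto
  then show "((f \<circ> \<gamma>) has_vector_derivative D v) (at 0)"
    by (rule has_vector_derivative_near[where A = "{-e<..<e}"])
       (use e assms(2) in \<open>auto simp: image_subset_iff\<close>)
qed

lemma curve_in_Pair:
  assumes "curve_in M p v \<gamma>" "curve_in M' p' v' \<gamma>'"
  shows "curve_in (M \<times> M') (p, p') (v, v') (\<lambda>t. (\<gamma> t, \<gamma>' t))"
proof -
  obtain e where e: "e > 0" "smooth_on_open {-e<..<e} \<gamma>" "\<gamma> ` {-e<..<e} \<subseteq> M"
    using assms(1) unfolding curve_in_def by blast
  obtain e' where e': "e' > 0" "smooth_on_open {-e'<..<e'} \<gamma>'" "\<gamma>' ` {-e'<..<e'} \<subseteq> M'"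
    using assms(2) unfolding curve_in_def by blast
  define r where "r = min e e'"
  have r: "r > 0" "{-r<..<r} \<subseteq> {-e<..<e}" "{-r<..<r} \<subseteq> {-e'<..<e'}"
    using e(1) e'(1) by (auto simp: r_def)
  have "smooth_on_open {-r<..<r} (\<lambda>t. (\<gamma> t, \<gamma>' t))"
    using r by (intro smooth_Pair smooth_subset[OF e(2)] smooth_subset[OF e'(2)]) auto
  moreover have "(\<lambda>t. (\<gamma> t, \<gamma>' t)) ` {-r<..<r} \<subseteq> M \<times> M'"
    using e(3) e'(3) r(2,3) by (auto simp: image_subset_iff subset_iff)
  moreover have "((\<lambda>t. (\<gamma> t, \<gamma>' t)) has_vector_derivative (v, v')) (at 0)"
    using assms unfolding curve_in_def by (intro has_vector_derivative_Pair) auto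
  ultimately show ?thesis
    using assms r(1) unfolding curve_in_def by auto
qed

text \<open>Differentiating a constant quadratic expression along a curve gives the linear equations of
the tangent spaces: with the inner product for spheres, and with \<open>R ** transpose R\<close> for the
rotation group.\<close>

lemma curve_in_constant_bilinear:
  assumes "curve_in M p v \<gamma>" "bounded_bilinear h" "\<And>x. x \<in> M \<Longrightarrow> h x x = c"
  shows "h p v + h v p = 0"
proof -
  obtain e where e: "e > 0" "\<gamma> ` {-e<..<e} \<subseteq> M" and \<gamma>: "\<gamma> 0 = p" "(\<gamma> has_vector_derivative v) (at 0)"
    using assms(1) unfolding curve_in_def by blast
  have "((\<lambda>t. h (\<gamma> t) (\<gamma> t)) has_vector_derivative h p v + h v p) (at 0)"
    using bounded_bilinear.has_vector_derivative[OF assms(2) \<gamma>(2) \<gamma>(2)] \<gamma>(1) by simp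
  moreover have "((\<lambda>t. h (\<gamma> t) (\<gamma> t)) has_vector_derivative 0) (at 0)"
    by (rule has_vector_derivative_near[where g = "\<lambda>t. c" and A = "{-e<..<e}"])
       (use e assms(3) in \<open>auto simp: image_subset_iff\<close>)
  ultimately show ?thesis by (rule vector_derivative_unique_at)
qed


section \<open>Rotations and tangent spaces\<close>

text \<open>Inverses of rotations are transposes; the default rewriting of a transpose acting on the left
into a row-vector product would hide them.\<close>

declare transpose_matrix_vector [simp del]

lemma SO3_D:
  assumes "R \<in> SO3"
  shows "transpose R ** R = mat 1" "R ** transpose R = mat 1" "matrix_inv R = transpose R"
    "rotation_matrix R" "invertible R"
proof -
  show *: "transpose R ** R = mat 1" "R ** transpose R = mat 1" "rotation_matrix R"
    using assms by (auto simp: SO3_def rotation_matrix_def orthogonal_matrix_def)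
  then show "invertible R" unfolding invertible_def by blast
  then have "matrix_inv R ** R = mat 1"
    unfolding invertible_def matrix_inv_def by (rule someI2_ex) blast
  then show "matrix_inv R = transpose R"
    using *(2) by (metis matrix_mul_assoc matrix_mul_lid matrix_mul_rid)
qed

lemma SO3_inverse_vec:
  assumes "R \<in> SO3"
  shows "transpose R *v (R *v v) = v" "R *v (transpose R *v v) = v"
  using SO3_D(1,2)[OF assms] by (simp_all add: matrix_vector_mul_assoc)

lemma SO3_mult: "S \<in> SO3 \<Longrightarrow> T \<in> SO3 \<Longrightarrow> S ** T \<in> SO3"
  by (auto simp: SO3_def rotation_matrix_def orthogonal_matrix_mul det_mul)

lemma SO3_transpose: "S \<in> SO3 \<Longrightarrow> transpose S \<in> SO3"
  by (auto simp: SO3_def rotation_matrix_def)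

lemma SO3_one: "mat 1 \<in> SO3"
  by (auto simp: SO3_def rotation_matrix_def orthogonal_matrix_id)

lemma SO3_inner: "R \<in> SO3 \<Longrightarrow> (R *v v) \<bullet> (R *v w) = v \<bullet> w"
  by (metis SO3_inverse_vec(1) dot_lmul_matrix transpose_matrix_vector inner_commute)

lemma SO3_norm: "R \<in> SO3 \<Longrightarrow> norm (R *v v) = norm v"
  by (simp add: norm_eq_sqrt_inner SO3_inner)

lemma SO3_cross: "R \<in> SO3 \<Longrightarrow> cross3 (R *v v) (R *v w) = R *v cross3 v w"
  by (rule cross_rotation_matrix) (rule SO3_D)

lemma cross_mat_mult_vec [simp]: "cross_mat w *v v = cross3 w v"
proof -
  have "linear (cross3 w)" by (simp add: linear_iff cross_add_right cross_mult_right)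
  from fun_cong[OF matrix_vector_mul(2)[OF this]] show ?thesis unfolding cross_mat_def .
qed

lemma SO3_conj_cross_mat:
  assumes "S \<in> SO3"
  shows "S ** cross_mat w = cross_mat (S *v w) ** S"
  unfolding matrix_eq by (simp add: matrix_vector_mul_assoc[symmetric] SO3_cross[OF assms])

lemma skew_eq_cross_mat:
  fixes K :: "real^3^3"
  assumes "K + transpose K = 0"
  obtains w where "K = cross_mat w"
proof
  have k: "K $ i $ j + K $ j $ i = 0" for i j
    using assms by (simp add: vec_eq_iff transpose_def)
  show "K = cross_mat (vector [K $ 3 $ 2, K $ 1 $ 3, K $ 2 $ 1])"
    using k[of 1 1] k[of 2 2] k[of 3 3] k[of 1 2] k[of 2 3] k[of 1 3]
    by (simp add: cross_mat_def matrix_def vec_eq_iff forall_3 cross3_def vector_def axis_def)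
qed

lemma angular_velocity_iff:
  assumes "R \<in> SO3"
  shows "angular_velocity R R' w \<longleftrightarrow> R' = cross_mat w ** R"
  unfolding angular_velocity_def SO3_D(3)[OF assms]
  using SO3_D(1,2)[OF assms] by (metis matrix_mul_assoc matrix_mul_rid)

text \<open>The Cayley transform of \<open>t *\<^sub>R s\<close>, that is the rotation given by the unnormalised quaternion
with real part 1 and imaginary part \<open>t *\<^sub>R s\<close>. Unlike the exponential, it is rational in the
parameter, so its smoothness follows from the rules for products and reciprocals.\<close>

definition cayley_curve :: "real^3 \<Rightarrow> real \<Rightarrow> real^3^3" where
  "cayley_curve s t = mat 1 + (2 * inverse (1 + (t *\<^sub>R s) \<bullet> (t *\<^sub>R s))) *\<^sub>R
     (cross_mat (t *\<^sub>R s) + cross_mat (t *\<^sub>R s) ** cross_mat (t *\<^sub>R s))"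

lemma cayley_curve_0 [simp]: "cayley_curve s 0 = mat 1"
  by (simp add: cayley_curve_def linear_0[OF bounded_linear.linear[OF bounded_linear_cross_mat]])

text \<open>With \<open>K\<close> the cross product matrix one has \<open>K ** K ** K = - (s \<bullet> s) *\<^sub>R K\<close>. Hence the defects of
orthogonality and of the determinant are both multiples of \<open>c * (1 + s \<bullet> s) - 2\<close>.\<close>

lemma cayley_in_SO3:
  fixes s :: "real^3"
  assumes c: "c * (1 + s \<bullet> s) = 2"
  shows "mat 1 + c *\<^sub>R (cross_mat s + cross_mat s ** cross_mat s) \<in> SO3"
proof -
  define x y z where "x = s $ 1" and "y = s $ 2" and "z = s $ 3"
  have K: "cross_mat s = vector [vector [0, - z, y], vector [z, 0, - x], vector [- y, x, 0]]"
    by (simp add: cross_mat_def matrix_def vec_eq_iff forall_3 cross3_def vector_def axis_def x_def y_def z_def)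
  have c': "c * (1 + x * x + y * y + z * z) = 2"
    using c by (simp add: inner_vec_def sum_3 x_def y_def z_def add.assoc)
  let ?M = "mat 1 + c *\<^sub>R (cross_mat s + cross_mat s ** cross_mat s)"
  have M: "?M = vector [vector [1 - c * (y*y + z*z), c * (x*y - z), c * (x*z + y)],
     vector [c * (x*y + z), 1 - c * (x*x + z*z), c * (y*z - x)],
     vector [c * (x*z - y), c * (y*z + x), 1 - c * (x*x + y*y)]]"
    unfolding K by (simp add: vec_eq_iff forall_3 vector_def matrix_matrix_mult_def sum_3 mat_def algebra_simps)
  have "transpose ?M ** ?M = mat 1 - (c * (c * (1 + x * x + y * y + z * z) - 2)) *\<^sub>R
     vector [vector [- (y*y + z*z), x*y, x*z], vector [x*y, - (x*x + z*z), y*z], vector [x*z, y*z, - (x*x + y*y)]]"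
    unfolding M
    by (simp add: vec_eq_iff forall_3 vector_def matrix_matrix_mult_def transpose_def sum_3 mat_def)
       (simp add: algebra_simps)
  then have "transpose ?M ** ?M = mat 1" using c' by simp
  moreover have "det ?M = 1 + c * (x * x + y * y + z * z) * (c * (1 + x * x + y * y + z * z) - 2)"
    unfolding M det_3 by (simp add: vector_def) (simp only: algebra_simps)
  then have "det ?M = 1" using c' by simp
  ultimately show ?thesis
    by (simp add: SO3_def rotation_matrix_def orthogonal_matrix)
qed

lemma cayley_curve_in_SO3: "cayley_curve s t \<in> SO3"
proof -
  have "1 + (t *\<^sub>R s) \<bullet> (t *\<^sub>R s) \<noteq> 0"
    using inner_ge_zero[of "t *\<^sub>R s"] by linarith
  then show ?thesis unfolding cayley_curve_def by (intro cayley_in_SO3) simp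
qed

lemma smooth_cayley_curve: "smooth_on_open UNIV (cayley_curve s)"
proof -
  have "1 + (t *\<^sub>R s) \<bullet> (t *\<^sub>R s) \<noteq> 0" for t
    using inner_ge_zero[of "t *\<^sub>R s"] by linarith
  then show ?thesis unfolding cayley_curve_def by (intro smooth_intros) auto
qed

lemma cayley_curve_derivative: "(cayley_curve s has_vector_derivative 2 *\<^sub>R cross_mat s) (at 0)"
proof -
  define K where "K = cross_mat s"
  have k: "cross_mat (t *\<^sub>R s) = t *\<^sub>R K" for t
    unfolding K_def by (simp add: linear_cmul[OF bounded_linear.linear[OF bounded_linear_cross_mat]])
  have "cayley_curve s = (\<lambda>t. mat 1 + (2 * inverse (1 + t * t * (s \<bullet> s))) *\<^sub>R (t *\<^sub>R K + (t * t) *\<^sub>R (K ** K)))"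
    unfolding cayley_curve_def k
    by (simp add: bounded_bilinear.scaleR_left[OF bounded_bilinear_matrix_matrix_mult]
        bounded_bilinear.scaleR_right[OF bounded_bilinear_matrix_matrix_mult] mult.assoc)
  moreover have "(\<dots> has_vector_derivative 2 *\<^sub>R K) (at 0)"
    by (auto intro!: derivative_eq_intros)
  ultimately show ?thesis by (simp add: K_def)
qed

text \<open>The source of all curves that are needed to realise tangent vectors, on spheres as well as in
the rotation group.\<close>

lemma curve_in_cayley:
  fixes c :: "real^3^3 \<Rightarrow> 'a::euclidean_space"
  assumes "linear c" "\<And>S. S \<in> SO3 \<Longrightarrow> c S \<in> M"
  shows "curve_in M (c (mat 1)) (c (cross_mat w)) (\<lambda>t. c (cayley_curve (w /\<^sub>R 2) t))"
proof -
  \<comment> \<open>The Cayley transform moves at twice the speed of its parameter, whence the factor one half.\<close>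
  have c: "bounded_linear c" using assms(1) linear_conv_bounded_linear by blast
  have "smooth_on_open {-1<..<1::real} (\<lambda>t. c (cayley_curve (w /\<^sub>R 2) t))"
    by (intro smooth_linear[OF _ c] smooth_subset[OF smooth_cayley_curve]) auto
  moreover have "((\<lambda>t. c (cayley_curve (w /\<^sub>R 2) t)) has_vector_derivative c (2 *\<^sub>R cross_mat (w /\<^sub>R 2))) (at 0)"
    by (rule bounded_linear.has_vector_derivative[OF c cayley_curve_derivative])
  moreover have "2 *\<^sub>R cross_mat (w /\<^sub>R 2) = cross_mat w"
    by (simp add: linear_cmul[OF bounded_linear.linear[OF bounded_linear_cross_mat]])
  moreover have "c (cayley_curve (w /\<^sub>R 2) t) \<in> M" for t
    by (intro assms(2) cayley_curve_in_SO3)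
  ultimately show ?thesis
    unfolding curve_in_def by (auto intro!: exI[of _ "1::real"])
qed

lemma cross_on_perp:
  fixes q v :: "real^3"
  assumes "q \<bullet> v = 0" "norm q = r" "r > 0"
  shows "cross3 (cross3 q v /\<^sub>R r\<^sup>2) q = v"
proof -
  have "cross3 (cross3 q v) q = - cross3 q (cross3 q v)" by (rule cross_skew)
  also have "\<dots> = r\<^sup>2 *\<^sub>R v" using assms by (simp add: Lagrange power2_norm_eq_inner[symmetric])
  finally show ?thesis using assms by (simp add: cross_mult_left)
qed

lemma tangent_space_sphere:
  fixes q :: "real^3"
  assumes "q \<in> sphere 0 r" "r > 0"
  shows "tangent_space (sphere 0 r) q = {v. q \<bullet> v = 0}"
proof (intro equalityI subsetI)
  fix v assume "v \<in> tangent_space (sphere 0 r) q"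
  then obtain \<gamma> where "curve_in (sphere 0 r) q v \<gamma>" unfolding tangent_space_def by blast
  then have "q \<bullet> v + v \<bullet> q = 0"
    by (rule curve_in_constant_bilinear[OF _ bounded_bilinear_inner, where c = "r\<^sup>2"])
       (simp add: power2_norm_eq_inner[symmetric])
  then show "v \<in> {v. q \<bullet> v = 0}" by (simp add: inner_commute)
next
  fix v assume v: "v \<in> {v. q \<bullet> v = 0}"
  let ?w = "cross3 q v /\<^sub>R r\<^sup>2"
  have "curve_in (sphere 0 r) (mat 1 *v q) (cross_mat ?w *v q) (\<lambda>t. cayley_curve (?w /\<^sub>R 2) t *v q)"
    by (rule curve_in_cayley)
       (use assms in \<open>auto simp: SO3_norm linear_iff matrix_vector_mult_add_rdistrib scaleR_matrix_vector_assoc\<close>)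
  moreover have "cross_mat ?w *v q = v" using cross_on_perp[of q v r] assms v by simp
  ultimately show "v \<in> tangent_space (sphere 0 r) q"
    unfolding tangent_space_def by auto
qed

lemma config_space_iff: "(q, R) \<in> config_space a \<longleftrightarrow> norm q = a \<and> R \<in> SO3"
  by (simp add: config_space_def)

lemma tangent_space_config:
  assumes p: "(q, R) \<in> config_space a" and a: "a > 0"
  shows "tangent_space (config_space a) (q, R) = {(v, cross_mat w ** R) | v w. q \<bullet> v = 0}"
proof (intro equalityI subsetI)
  fix u assume "u \<in> tangent_space (config_space a) (q, R)"
  then obtain \<gamma> where \<gamma>: "curve_in (config_space a) (q, R) u \<gamma>" unfolding tangent_space_def by blast
  obtain v R' where u: "u = (v, R')" by fastforce
  have R: "R \<in> SO3" using p by (simp add: config_space_iff)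
  have "bounded_bilinear (\<lambda>x y :: config. fst x \<bullet> fst y)"
    by (rule bounded_bilinear.comp[OF bounded_bilinear_inner bounded_linear_fst bounded_linear_fst])
  from curve_in_constant_bilinear[OF \<gamma> this, where c = "a\<^sup>2"]
  have 1: "q \<bullet> v = 0"
    by (auto simp: config_space_def power2_norm_eq_inner[symmetric] u inner_commute)
  have "bounded_bilinear (\<lambda>x y :: config. snd x ** transpose (snd y))"
    by (rule bounded_bilinear.comp[OF bounded_bilinear_matrix_matrix_mult bounded_linear_snd
          bounded_linear_compose[OF bounded_linear_transpose bounded_linear_snd]])
  from curve_in_constant_bilinear[OF \<gamma> this, where c = "mat 1"]
  have "R ** transpose R' + R' ** transpose R = 0"
    by (auto simp: config_space_def SO3_D u)
  then have "R' ** transpose R + transpose (R' ** transpose R) = 0"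
    by (simp add: matrix_transpose_mul add.commute)
  then obtain w where "R' ** transpose R = cross_mat w" by (rule skew_eq_cross_mat)
  then have "R' = cross_mat w ** R"
    using SO3_D(1)[OF R] by (metis matrix_mul_assoc matrix_mul_rid)
  with 1 u show "u \<in> {(v, cross_mat w ** R) | v w. q \<bullet> v = 0}" by blast
next
  fix u assume "u \<in> {(v, cross_mat w ** R) | v w. q \<bullet> v = 0}"
  then obtain v w where u: "u = (v, cross_mat w ** R)" and v: "q \<bullet> v = 0" by blast
  let ?s = "cross3 q v /\<^sub>R a\<^sup>2"
  have "curve_in (sphere 0 a) (mat 1 *v q) (cross_mat ?s *v q) (\<lambda>t. cayley_curve (?s /\<^sub>R 2) t *v q)"
    by (rule curve_in_cayley)
       (use p in \<open>auto simp: config_space_iff SO3_norm linear_iff matrix_vector_mult_add_rdistrib scaleR_matrix_vector_assoc\<close>)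
  moreover have "cross_mat ?s *v q = v" using cross_on_perp[of q v a] p a v by (simp add: config_space_iff)
  ultimately have 1: "curve_in (sphere 0 a) q v (\<lambda>t. cayley_curve (?s /\<^sub>R 2) t *v q)" by simp
  have "curve_in SO3 (mat 1 ** R) (cross_mat w ** R) (\<lambda>t. cayley_curve (w /\<^sub>R 2) t ** R)"
    by (rule curve_in_cayley)
       (use p in \<open>auto simp: config_space_iff SO3_mult intro!: bounded_linear.linear
          bounded_bilinear.bounded_linear_left[OF bounded_bilinear_matrix_matrix_mult]\<close>)
  then have 2: "curve_in SO3 R (cross_mat w ** R) (\<lambda>t. cayley_curve (w /\<^sub>R 2) t ** R)" by simp
  show "u \<in> tangent_space (config_space a) (q, R)"
    unfolding u tangent_space_def config_space_def using curve_in_Pair[OF 1 2] by blast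
qed


section \<open>The principal bundle\<close>

text \<open>The inversion centred at \<open>- p\<close> of squared radius 2. For a unit vector \<open>p\<close> it is stereographic
projection between the unit sphere and the hyperplane orthogonal to \<open>p\<close>, in both directions at
once, because it is an involution.\<close>

definition inversion :: "'a::euclidean_space \<Rightarrow> 'a \<Rightarrow> 'a" where
  "inversion p z = (2 * inverse ((z + p) \<bullet> (z + p))) *\<^sub>R (z + p) - p"

lemma smooth_inversion: "smooth_on_open (- {- p}) (inversion p)"
proof -
  have "smooth_on_open (- {- p}) (\<lambda>z. (2 * inverse ((z + p) \<bullet> (z + p))) *\<^sub>R (z + p) + - p)"
    by (intro smooth_intros) (auto simp: open_Compl add_eq_0_iff2)
  then show ?thesis unfolding inversion_def[abs_def] by simp
qed

lemma inversion_involution: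
  assumes "z \<noteq> - p"
  shows "inversion p z \<noteq> - p" "inversion p (inversion p z) = z"
proof -
  let ?d = "(z + p) \<bullet> (z + p)"
  have d: "?d \<noteq> 0" using assms by (simp add: add_eq_0_iff2)
  have j: "inversion p z + p = (2 * inverse ?d) *\<^sub>R (z + p)" by (simp add: inversion_def)
  have "z + p \<noteq> 0" using assms by (simp add: add_eq_0_iff2)
  then have "inversion p z + p \<noteq> 0" unfolding j using d by simp
  then show "inversion p z \<noteq> - p" by (metis add.left_inverse)
  have "(inversion p z + p) \<bullet> (inversion p z + p) = 4 * inverse ?d"
    unfolding j inner_scaleR_left inner_scaleR_right using d by (simp add: field_simps)
  then have "inversion p (inversion p z) = (2 * inverse (4 * inverse ?d)) *\<^sub>R (2 * inverse ?d) *\<^sub>R (z + p) - p"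
    using j by (metis inversion_def)
  then show "inversion p (inversion p z) = z" using d by simp
qed

lemma inversion_perp_sphere:
  assumes "norm p = 1"
  shows "p \<bullet> y = 0 \<Longrightarrow> y \<noteq> - p" "p \<bullet> y = 0 \<Longrightarrow> norm (inversion p y) = 1"
    and "norm x = 1 \<Longrightarrow> x \<noteq> - p \<Longrightarrow> p \<bullet> inversion p x = 0"
proof -
  have p: "p \<bullet> p = 1" using assms by (simp add: norm_eq_1)
  {
    assume y: "p \<bullet> y = 0"
    then show "y \<noteq> - p" using p by auto
    let ?d = "(y + p) \<bullet> (y + p)"
    have pd: "p \<bullet> (y + p) = 1" using y p by (simp add: inner_right_distrib)
    have d: "?d \<noteq> 0" using \<open>y \<noteq> - p\<close> by (simp add: add_eq_0_iff2)
    have "inversion p y \<bullet> inversion p y = (2 * inverse ?d)\<^sup>2 * ?d - 2 * (2 * inverse ?d) * (p \<bullet> (y + p)) + p \<bullet> p"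
      unfolding inversion_def by (simp add: inner_diff_left inner_diff_right power2_eq_square inner_commute)
    also have "\<dots> = 1" unfolding pd p using d by (simp add: power2_eq_square field_simps)
    finally show "norm (inversion p y) = 1" by (simp add: norm_eq_1)
  }
  assume x: "norm x = 1" "x \<noteq> - p"
  have d: "(x + p) \<bullet> (x + p) = 2 * (p \<bullet> (x + p))"
    using p x(1) by (simp add: norm_eq_1 inner_add_left inner_add_right inner_commute)
  have "(x + p) \<bullet> (x + p) \<noteq> 0" using x by (simp add: add_eq_0_iff2)
  then show "p \<bullet> inversion p x = 0"
    unfolding inversion_def d by (simp add: inner_diff_right p)
qed

lemma submanifold_unit_sphere: "submanifold (DIM('a) - 1) (sphere 0 1 :: 'a::euclidean_space set)"
  unfolding submanifold_def
proof
  fix p :: 'a assume "p \<in> sphere 0 1"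
  then have p: "norm p = 1" by simp
  let ?L = "{y. p \<bullet> y = 0}"
  have "diffeo ?L (sphere 0 1 \<inter> - {- p}) (inversion p)"
  proof (rule diffeoI)
    show "smooth_map ?L (inversion p)" "smooth_map (sphere 0 1 \<inter> - {- p}) (inversion p)"
      by (rule smooth_mapI[OF _ _ smooth_inversion];
          use inversion_perp_sphere[OF p] in \<open>auto simp: open_Compl\<close>)+
    show "inversion p ` ?L \<subseteq> sphere 0 1 \<inter> - {- p}"
      using inversion_perp_sphere(1,2)[OF p] inversion_involution(1)[of _ p]
      by (auto simp del: ComplD) metis+
    show "inversion p ` (sphere 0 1 \<inter> - {- p}) \<subseteq> ?L"
      using inversion_perp_sphere(3)[OF p] by auto
  qed (simp_all add: inversion_involution(2)[OF inversion_perp_sphere(1)[OF p]] inversion_involution(2))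
  moreover have "open (- {- p})" by (simp add: open_Compl)
  moreover have "p \<in> - {- p}"
  proof
    assume "p \<in> {- p}"
    then have "p \<bullet> p = (- p) \<bullet> p" by (metis singletonD)
    then show False using p by (simp add: norm_eq_1)
  qed
  moreover have "subspace ?L" by (rule subspace_hyperplane)
  moreover have "openin (top_of_set ?L) ?L" by simp
  moreover have "dim ?L = DIM('a) - 1" using p by (intro dim_hyperplane) auto
  ultimately show "\<exists>U (L :: 'a set) V \<phi>. open U \<and> p \<in> U \<and> subspace L \<and> dim L = DIM('a) - 1 \<and>
      openin (top_of_set L) V \<and> diffeo V (sphere 0 1 \<inter> U) \<phi>"
    by blast
qed

lemma closed_SO3: "closed SO3"
proof -
  have "continuous_on UNIV (\<lambda>A :: real^3^3. transpose A ** A)"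
    by (intro smooth_imp_continuous smooth_intros) auto
  moreover have "continuous_on UNIV (\<lambda>A :: real^3^3. det A)"
    unfolding det_3 by (intro continuous_intros)
  ultimately have "closed ({A. transpose A ** A = mat 1} \<inter> {A :: real^3^3. det A = 1})"
    by (intro closed_Int closed_Collect_eq continuous_on_const)
  moreover have "SO3 = {A. transpose A ** A = mat 1} \<inter> {A. det A = 1}"
    by (auto simp: SO3_def rotation_matrix_def orthogonal_matrix)
  ultimately show ?thesis by simp
qed

lemma matrix_lie_group_SO3: "matrix_lie_group SO3"
  unfolding matrix_lie_group_def
  using SO3_D(3,5) SO3_mult SO3_one SO3_transpose closed_SO3 by (auto intro!: closed_subset)

lemma bundle_proj_eq:
  "R \<in> SO3 \<Longrightarrow> bundle_proj a (q, R) = (1 / a) *\<^sub>R (transpose R *v q)"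
  by (simp add: bundle_proj_def SO3_D)

lemma smooth_bundle_proj: "smooth_map (config_space a) (bundle_proj a)"
proof (rule smooth_mapI[OF open_UNIV])
  show "smooth_on_open UNIV (\<lambda>p :: config. (1 / a) *\<^sub>R (transpose (snd p) *v fst p))"
    by (intro smooth_intros) auto
qed (auto simp: config_space_def bundle_proj_eq)

lemma bundle_proj_sphere:
  "a > 0 \<Longrightarrow> p \<in> config_space a \<Longrightarrow> bundle_proj a p \<in> sphere 0 1"
  by (cases p) (auto simp: config_space_def bundle_proj_eq SO3_norm[OF SO3_transpose])

lemma bundle_proj_action:
  "S \<in> SO3 \<Longrightarrow> p \<in> config_space a \<Longrightarrow> bundle_proj a (diag_action S p) = bundle_proj a p"
  by (cases p) (auto simp: config_space_def bundle_proj_eq diag_action_def SO3_mult matrix_transpose_mul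
      matrix_vector_mul_assoc[symmetric] SO3_inverse_vec)

lemma action_config_space:
  "S \<in> SO3 \<Longrightarrow> p \<in> config_space a \<Longrightarrow> diag_action S p \<in> config_space a"
  by (cases p) (auto simp: config_space_def diag_action_def SO3_mult SO3_norm)

text \<open>The bundle is trivial: \<open>(q, R)\<close> corresponds to the pair of its projection and \<open>R\<close>, and the
inverse sends \<open>(b, S)\<close> to \<open>(a *\<^sub>R (S *v b), S)\<close>. Both maps are polynomial.\<close>

lemma principal_bundle_config:
  assumes a: "a > 0"
  shows "principal_bundle SO3 diag_action (config_space a) (bundle_proj a) (sphere 0 1)"
  unfolding principal_bundle_def
proof (intro conjI ballI allI impI)
  let ?P = "config_space a" and ?\<phi> = "\<lambda>p. (bundle_proj a p, snd p)"
  have P: "R \<in> SO3" if "(q, R) \<in> ?P" for q R using that by (simp add: config_space_def)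
  show "matrix_lie_group SO3" by (rule matrix_lie_group_SO3)
  show "\<exists>k. submanifold k (sphere (0 :: real^3) 1)" using submanifold_unit_sphere by blast
  show "smooth_map (SO3 \<times> ?P) (\<lambda>(S, p). diag_action S p)"
  proof (rule smooth_mapI[OF open_UNIV])
    show "smooth_on_open UNIV (\<lambda>z :: (real^3^3) \<times> config. (fst z *v fst (snd z), fst z ** snd (snd z)))"
      by (intro smooth_intros) auto
  qed (auto simp: diag_action_def)
  show "smooth_map ?P (bundle_proj a)" by (rule smooth_bundle_proj)
  show "bundle_proj a ` ?P = sphere 0 1"
  proof (intro equalityI subsetI)
    fix b :: "real^3" assume "b \<in> sphere 0 1"
    then have "(a *\<^sub>R b, mat 1) \<in> ?P" "bundle_proj a (a *\<^sub>R b, mat 1) = b"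
      using a by (simp_all add: config_space_def SO3_one bundle_proj_eq)
    then show "b \<in> bundle_proj a ` ?P" by (metis imageI)
  qed (use bundle_proj_sphere[OF a] in blast)
  show "diag_action S p \<in> ?P" "bundle_proj a (diag_action S p) = bundle_proj a p"
    if "S \<in> SO3" "p \<in> ?P" for S p
    using that by (rule action_config_space bundle_proj_action)+
  show "diag_action (mat 1) p = p" if "p \<in> ?P" for p
    by (cases p) (simp add: diag_action_def)
  show "diag_action (S ** T) p = diag_action S (diag_action T p)" for S T p
    by (cases p) (simp add: diag_action_def matrix_vector_mul_assoc matrix_mul_assoc)
  fix b :: "real^3" assume "b \<in> sphere 0 1"
  have "diffeo {p \<in> ?P. bundle_proj a p \<in> UNIV} ((sphere 0 1 \<inter> UNIV) \<times> SO3) ?\<phi>"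
  proof (rule diffeoI[where g = "\<lambda>z. (a *\<^sub>R (snd z *v fst z), snd z)"])
    show "smooth_map {p \<in> ?P. bundle_proj a p \<in> UNIV} ?\<phi>"
    proof (rule smooth_mapI[OF open_UNIV])
      show "smooth_on_open UNIV (\<lambda>p :: config. ((1 / a) *\<^sub>R (transpose (snd p) *v fst p), snd p))"
        by (intro smooth_intros) auto
    qed (auto simp: config_space_def bundle_proj_eq)
    show "smooth_map ((sphere 0 1 \<inter> UNIV) \<times> SO3) (\<lambda>z. (a *\<^sub>R (snd z *v fst z), snd z))"
      by (rule smooth_mapI[OF open_UNIV subset_UNIV _ refl]) (intro smooth_intros; simp)
  qed (use a in \<open>auto simp: config_space_def bundle_proj_eq SO3_norm SO3_transpose SO3_inverse_vec
      matrix_vector_mult_scaleR\<close>)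
  then show "\<exists>U \<phi>. open U \<and> b \<in> U \<and>
      diffeo {p \<in> ?P. bundle_proj a p \<in> U} ((sphere 0 1 \<inter> U) \<times> SO3) \<phi> \<and>
      (\<forall>p\<in>?P. bundle_proj a p \<in> U \<longrightarrow> fst (\<phi> p) = bundle_proj a p \<and>
         (\<forall>S\<in>SO3. \<phi> (diag_action S p) = (bundle_proj a p, S ** snd (\<phi> p))))"
    by (intro exI[of _ UNIV] exI[of _ ?\<phi>])
       (auto simp: bundle_proj_action, simp add: diag_action_def)
qed


section \<open>The rolling constraints\<close>

text \<open>The no-slip condition prescribes \<open>cross3 w q\<close>, which determines the part of \<open>w\<close> orthogonal to
\<open>q\<close>; the no-twist condition removes the remaining part along \<open>q\<close>.\<close>

lemma cross_eq_solution:
  fixes q z w :: "real^3"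
  assumes "norm q = a" "a > 0" "q \<bullet> z = 0"
  shows "cross3 w q = z \<and> w \<bullet> q = 0 \<longleftrightarrow> w = (1 / a\<^sup>2) *\<^sub>R cross3 q z"
proof
  have qq: "q \<bullet> q = a\<^sup>2" using assms(1) by (simp add: power2_norm_eq_inner[symmetric])
  assume "cross3 w q = z \<and> w \<bullet> q = 0"
  then have "cross3 q z = a\<^sup>2 *\<^sub>R w" using qq by (auto simp: Lagrange inner_commute)
  then show "w = (1 / a\<^sup>2) *\<^sub>R cross3 q z" using assms(2) by simp
next
  assume w: "w = (1 / a\<^sup>2) *\<^sub>R cross3 q z"
  then have "cross3 w q = z"
    using cross_on_perp[of q z a] assms by (simp add: divide_inverse)
  with w show "cross3 w q = z \<and> w \<bullet> q = 0" by (simp add: dot_cross_self)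
qed

text \<open>Displacing a surface conjugates the differential of its Gauss map by the rotation part.\<close>

lemma dN_displaced_eq:
  assumes N: "smooth_map \<Sigma> N" and R: "R \<in> SO3" and y: "y \<in> \<Sigma>"
    and v: "transpose R *v v \<in> tangent_space \<Sigma> y"
  shows "dN_displaced \<Sigma> N (R, x) (R *v y + x) v = R *v tangent_map \<Sigma> N y (transpose R *v v)"
proof -
  let ?g = "move (R, x)" and ?h = "\<lambda>z. transpose R *v (z - x)" and ?w = "transpose R *v v"
  have g: "?g = (\<lambda>y. R *v y + x)" by (auto simp: move_def)
  have hg: "?h (?g z) = z" for z by (simp add: g SO3_inverse_vec[OF R])
  have blR: "bounded_linear ((*v) A)" for A :: "real^3^3"
    by (rule bounded_bilinear.bounded_linear_right[OF bounded_bilinear_matrix_vector_mult])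
  have dg: "(?g has_derivative (*v) R) (at z)" for z
    unfolding g using bounded_linear_imp_has_derivative[OF blR] by (auto intro!: derivative_eq_intros)
  have dh: "(?h has_derivative (*v) (transpose R)) (at z)" for z
    by (rule bounded_linear.has_derivative[OF blR, THEN has_derivative_eq_rhs])
       (auto intro!: derivative_eq_intros)
  have "smooth_map \<Sigma> ?g" unfolding g
    by (rule smooth_mapI[OF open_UNIV subset_UNIV _ refl]) (intro smooth_intros; simp)
  from tangent_map_in_tangent_space[OF this subset_refl v] tangent_map_has_derivative[OF dg refl v]
  have tv: "v \<in> tangent_space (?g ` \<Sigma>) (R *v y + x)"
    by (simp add: SO3_inverse_vec[OF R] g)
  have "smooth_on_open UNIV (\<lambda>z. transpose R *v (z + - x))"
    by (intro smooth_intros) auto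
  then have sh: "smooth_map (?g ` \<Sigma>) ?h"
    by (intro smooth_mapI[OF open_UNIV subset_UNIV]) auto
  have th: "tangent_map (?g ` \<Sigma>) ?h (R *v y + x) v = ?w"
    by (rule tangent_map_has_derivative[OF dh refl tv])
  show ?thesis
    unfolding dN_displaced_def
  proof (rule tangent_map_eqI[OF tv])
    fix \<gamma> assume "curve_in (?g ` \<Sigma>) (R *v y + x) v \<gamma>"
    moreover have "?h ` ?g ` \<Sigma> \<subseteq> \<Sigma>" by (auto simp: hg)
    ultimately have "curve_in \<Sigma> (?h (R *v y + x)) ?w (?h \<circ> \<gamma>)"
      unfolding th[symmetric] by (intro curve_in_compose sh)
    then have "curve_in \<Sigma> y ?w (?h \<circ> \<gamma>)" by (simp add: SO3_inverse_vec[OF R])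
    from bounded_linear.has_vector_derivative[OF blR smooth_map_has_derivative_along[OF N this], of R]
    show "((displaced_gauss (R, x) N \<circ> \<gamma>) has_vector_derivative R *v tangent_map \<Sigma> N y ?w) (at 0)"
      by (simp add: displaced_gauss_def o_def SO3_D(3)[OF R])
  qed
qed

lemma no_twist_iff: "a > 0 \<Longrightarrow> no_twist a (q, R) w \<longleftrightarrow> w \<bullet> q = 0"
  by (simp add: no_twist_def N1_def)

text \<open>The body normal at the contact point, in the body frame. It is defined with the transpose so as
to be polynomial on the whole ambient space.\<close>

definition body_normal :: "real \<Rightarrow> config \<Rightarrow> real^3" where
  "body_normal a p = - ((1 / a) *\<^sub>R (transpose (snd p) *v fst p))"

lemma body_normal_eq: "p \<in> config_space a \<Longrightarrow> body_normal a p = - bundle_proj a p"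
  by (cases p) (simp add: config_space_def body_normal_def bundle_proj_eq)

lemma smooth_body_normal: "smooth_on_open UNIV (body_normal a)"
  unfolding body_normal_def[abs_def] by (intro smooth_intros) auto

lemma body_normal_sphere: "a > 0 \<Longrightarrow> p \<in> config_space a \<Longrightarrow> body_normal a p \<in> sphere 0 1"
  using bundle_proj_sphere by (simp add: body_normal_eq)

lemma body_normal_action:
  "S \<in> SO3 \<Longrightarrow> p \<in> config_space a \<Longrightarrow> body_normal a (diag_action S p) = body_normal a p"
  by (simp add: body_normal_eq bundle_proj_action action_config_space)

lemma transpose_cross_mat: "transpose (cross_mat w) = - cross_mat w"
  by (simp add: cross_mat_def matrix_def vec_eq_iff forall_3 cross3_def vector_def axis_def transpose_def)

lemma perp_body_normal_iff:
  assumes "(q, R) \<in> config_space a" "a > 0"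
  shows "body_normal a (q, R) \<bullet> (transpose R *v v) = 0 \<longleftrightarrow> q \<bullet> v = 0"
proof -
  have R: "R \<in> SO3" using assms by (simp add: config_space_iff)
  have "body_normal a (q, R) \<bullet> (transpose R *v v) = - ((1 / a) * (q \<bullet> v))"
    by (simp add: body_normal_def SO3_inner[OF SO3_transpose[OF R]])
  then show ?thesis using assms(2) by simp
qed

lemma body_normal_derivative:
  "(body_normal a has_derivative
     (\<lambda>u. - ((1 / a) *\<^sub>R (transpose (snd p) *v fst u + transpose (snd u) *v fst p)))) (at p)"
  unfolding body_normal_def[abs_def]
  by (intro has_derivative_minus has_derivative_scaleR_right
      bounded_bilinear.FDERIV[OF bounded_bilinear_matrix_vector_mult]
      bounded_linear.has_derivative[OF bounded_linear_transpose] has_derivative_fst has_derivative_snd has_derivative_ident)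

lemma tangent_body_normal:
  assumes p: "(q, R) \<in> config_space a" and a: "a > 0" and u: "(v, cross_mat w ** R) \<in> tangent_space (config_space a) (q, R)"
  shows "tangent_map (config_space a) (body_normal a) (q, R) (v, cross_mat w ** R)
     = (1 / a) *\<^sub>R (transpose R *v (cross3 w q - v))"
proof -
  have "transpose (cross_mat w ** R) *v q = - (transpose R *v cross3 w q)"
    by (simp add: matrix_transpose_mul transpose_cross_mat matrix_vector_mul_assoc[symmetric]
       bounded_bilinear.minus_left[OF bounded_bilinear_matrix_vector_mult]
       bounded_bilinear.minus_right[OF bounded_bilinear_matrix_vector_mult])
  with tangent_map_has_derivative[OF body_normal_derivative refl u] show ?thesis
    by (simp add: matrix_vector_mult_diff_distrib scaleR_diff_right)
qed

locale rolling_body =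
  fixes a :: real and \<Sigma> :: "(real^3) set" and N :: "real^3 \<Rightarrow> real^3"
  assumes a: "a > 0" and gauss: "gauss_map \<Sigma> N" and diffeo: "diffeo \<Sigma> (sphere 0 1) N"
begin

abbreviation \<psi> :: "real^3 \<Rightarrow> real^3" where "\<psi> \<equiv> inv_into \<Sigma> N"
abbreviation d\<psi> :: "real^3 \<Rightarrow> real^3 \<Rightarrow> real^3" where "d\<psi> \<equiv> tangent_map (sphere 0 1) \<psi>"

lemma N_smooth: "smooth_map \<Sigma> N" and \<psi>_smooth: "smooth_map (sphere 0 1) \<psi>"
  using diffeo by (simp_all add: diffeo_def)

lemma \<psi>_image: "\<psi> ` sphere 0 1 = \<Sigma>" and N_\<psi>: "u \<in> sphere 0 1 \<Longrightarrow> N (\<psi> u) = u"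
proof -
  have bij: "bij_betw N \<Sigma> (sphere 0 1)" using diffeo by (simp add: diffeo_def)
  then show "\<psi> ` sphere 0 1 = \<Sigma>" by (rule bij_betw_imp_surj_on[OF bij_betw_inv_into])
  show "u \<in> sphere 0 1 \<Longrightarrow> N (\<psi> u) = u" by (rule bij_betw_inv_into_right[OF bij])
qed

lemma d\<psi>_tangent:
  assumes "u \<in> sphere 0 1" "u \<bullet> w = 0"
  shows "d\<psi> u w \<in> tangent_space \<Sigma> (\<psi> u)"
  using tangent_map_in_tangent_space[OF \<psi>_smooth _ , of \<Sigma> w u] assms \<psi>_image
  by (simp add: tangent_space_sphere)

lemma tangent_perp:
  assumes "u \<in> sphere 0 1" "v \<in> tangent_space \<Sigma> (\<psi> u)"
  shows "u \<bullet> v = 0"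
proof -
  have "\<psi> u \<in> \<Sigma>" using \<psi>_image assms(1) by blast
  then show ?thesis using gauss assms N_\<psi>[OF assms(1)] unfolding gauss_map_def by metis
qed

text \<open>This is the chain rule for \<open>N \<circ> \<psi>\<close>, which is the identity on the sphere.\<close>

lemma dN_d\<psi>:
  assumes u: "u \<in> sphere 0 1" and w: "u \<bullet> w = 0"
  shows "tangent_map \<Sigma> N (\<psi> u) (d\<psi> u w) = w"
proof -
  have "w \<in> tangent_space (sphere 0 1) u" using assms by (simp add: tangent_space_sphere)
  then obtain c where c: "curve_in (sphere 0 1) u w c" unfolding tangent_space_def by blast
  from smooth_map_has_derivative_along[OF N_smooth curve_in_compose[OF \<psi>_smooth _ c]]
  have 1: "((N \<circ> (\<psi> \<circ> c)) has_vector_derivative tangent_map \<Sigma> N (\<psi> u) (d\<psi> u w)) (at 0)"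
    using \<psi>_image by simp
  obtain e where e: "e > 0" "c ` {-e<..<e} \<subseteq> sphere 0 1" and "(c has_vector_derivative w) (at 0)"
    using c unfolding curve_in_def by blast
  from this(3) have "((N \<circ> (\<psi> \<circ> c)) has_vector_derivative w) (at 0)"
    by (rule has_vector_derivative_near[where A = "{-e<..<e}"])
       (use e N_\<psi> in \<open>auto simp: image_subset_iff\<close>)
  with 1 show ?thesis by (rule vector_derivative_unique_at)
qed

lemma d\<psi>_linear:
  assumes "u \<in> sphere 0 1"
  obtains C where "linear C" "\<And>w. u \<bullet> w = 0 \<Longrightarrow> d\<psi> u w = C w"
proof (rule tangent_map_linear_on[OF \<psi>_smooth assms])
  fix C assume C: "linear C" "\<And>w. w \<in> tangent_space (sphere 0 1) u \<Longrightarrow> d\<psi> u w = C w"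
  show thesis
    by (rule that[OF C(1)], rule C(2)) (use assms in \<open>simp add: tangent_space_sphere\<close>)
qed

text \<open>The Gauss map condition puts the image of the differential of \<open>\<psi>\<close> at \<open>u\<close> inside the plane
orthogonal to \<open>u\<close>, and this differential is injective on that plane by \<open>dN_d\<psi>\<close>.
Equality of dimensions makes it onto, so it is the two-sided inverse of the differential of \<open>N\<close>
and the tangent space of the surface is the whole plane.\<close>

lemma d\<psi>_dN:
  assumes u: "u \<in> sphere 0 1" and v: "u \<bullet> v = 0"
  shows "d\<psi> u (tangent_map \<Sigma> N (\<psi> u) v) = v" "u \<bullet> tangent_map \<Sigma> N (\<psi> u) v = 0"
    "v \<in> tangent_space \<Sigma> (\<psi> u)"
proof -
  let ?W = "{w. u \<bullet> w = 0}"
  obtain C where C: "linear C" "\<And>w. u \<bullet> w = 0 \<Longrightarrow> d\<psi> u w = C w" using d\<psi>_linear[OF u] by blast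
  have "inj_on C ?W"
    by (rule inj_on_inverseI[where g = "tangent_map \<Sigma> N (\<psi> u)"]) (use C(2) dN_d\<psi>[OF u] in fastforce)
  then have "dim (C ` ?W) = dim ?W"
    using C(1) by (intro dim_image_eq) (simp_all add: subspace_hyperplane span_eq_iff[THEN iffD2])
  moreover have "C ` ?W \<subseteq> ?W"
    using C(2) d\<psi>_tangent[OF u] tangent_perp[OF u] by force
  ultimately have "C ` ?W = ?W"
    by (intro subspace_dim_equal linear_subspace_image C(1) subspace_hyperplane) auto
  with v obtain w where w: "u \<bullet> w = 0" "v = d\<psi> u w" using C(2) by auto
  then show "d\<psi> u (tangent_map \<Sigma> N (\<psi> u) v) = v" "u \<bullet> tangent_map \<Sigma> N (\<psi> u) v = 0"
    "v \<in> tangent_space \<Sigma> (\<psi> u)"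
    using dN_d\<psi>[OF u w(1)] d\<psi>_tangent[OF u w(1)] by simp_all
qed

abbreviation P :: "config set" where "P \<equiv> config_space a"

lemma contact_eq: "(q, R) \<in> P \<Longrightarrow> contact_on_body a \<Sigma> N (q, R) = \<psi> (body_normal a (q, R))"
  by (simp add: contact_on_body_def body_normal_def N1_def config_space_def SO3_D matrix_vector_mult_scaleR)

lemma body_center_eq: "(q, R) \<in> P \<Longrightarrow> body_center a \<Sigma> N (q, R) = q - R *v \<psi> (body_normal a (q, R))"
  by (simp add: body_center_def contact_eq)

text \<open>The rotation \<open>S\<close> is included because equivariance compares the displaced body with its rotated
copy; \<open>S = mat 1\<close> gives the displaced body itself.\<close>

lemma dN_rotated_body:
  assumes p: "(q, R) \<in> P" and S: "S \<in> SO3" and v: "q \<bullet> v = 0"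
  shows "dN_displaced \<Sigma> N (motion_comp (rotation_motion S) (body_motion a \<Sigma> N (q, R))) (S *v q) (S *v v)
    = S *v (R *v tangent_map \<Sigma> N (\<psi> (body_normal a (q, R))) (transpose R *v v))"
proof -
  let ?u = "body_normal a (q, R)" and ?x = "body_center a \<Sigma> N (q, R)"
  have R: "R \<in> SO3" using p by (simp add: config_space_iff)
  have u: "?u \<in> sphere 0 1" by (rule body_normal_sphere[OF a p])
  have q: "S *v q = (S ** R) *v \<psi> ?u + S *v ?x"
    by (simp add: body_center_eq[OF p] matrix_vector_mult_diff_distrib matrix_vector_mul_assoc)
  have t: "transpose (S ** R) *v (S *v v) = transpose R *v v"
    by (simp add: matrix_transpose_mul matrix_vector_mul_assoc[symmetric] SO3_inverse_vec[OF S])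
  have "transpose R *v v \<in> tangent_space \<Sigma> (\<psi> ?u)"
    using perp_body_normal_iff[OF p a] v by (intro d\<psi>_dN u) simp
  then have "dN_displaced \<Sigma> N (S ** R, S *v ?x) ((S ** R) *v \<psi> ?u + S *v ?x) (S *v v)
    = (S ** R) *v tangent_map \<Sigma> N (\<psi> ?u) (transpose (S ** R) *v (S *v v))"
    by (intro dN_displaced_eq N_smooth SO3_mult S R) (use u \<psi>_image t in auto)
  then show ?thesis unfolding q[symmetric] t
    by (simp add: motion_comp_def rotation_motion_def body_motion_def matrix_vector_mul_assoc[symmetric])
qed

lemma dN_body:
  assumes p: "(q, R) \<in> P" and v: "q \<bullet> v = 0"
  shows "dN_displaced \<Sigma> N (body_motion a \<Sigma> N (q, R)) q v
    = R *v tangent_map \<Sigma> N (\<psi> (body_normal a (q, R))) (transpose R *v v)"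
  using dN_rotated_body[OF p SO3_one v] by (simp add: motion_comp_def rotation_motion_def)

text \<open>Along a motion the centre of mass is \<open>q - R *v \<psi> (body_normal a (q, R))\<close>; this is the product
rule for that expression.\<close>

lemma tangent_body_center:
  assumes p: "(q, R) \<in> P" and u: "(v, R') \<in> tangent_space P (q, R)"
  shows "tangent_map P (body_center a \<Sigma> N) (q, R) (v, R') =
    v - (R *v d\<psi> (body_normal a (q, R)) (tangent_map P (body_normal a) (q, R) (v, R'))
         + R' *v \<psi> (body_normal a (q, R)))"
proof (rule tangent_map_eqI[OF u])
  fix \<gamma> assume \<gamma>: "curve_in P (q, R) (v, R') \<gamma>"
  then obtain e where e: "e > 0" "\<gamma> ` {-e<..<e} \<subseteq> P" "\<gamma> 0 = (q, R)"
    and d: "(\<gamma> has_vector_derivative (v, R')) (at 0)"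
    unfolding curve_in_def by blast
  have "smooth_map P (body_normal a)"
    by (rule smooth_mapI[OF open_UNIV subset_UNIV smooth_body_normal refl])
  then have "curve_in (sphere 0 1) (body_normal a (q, R)) (tangent_map P (body_normal a) (q, R) (v, R')) (body_normal a \<circ> \<gamma>)"
    using body_normal_sphere[OF a] by (intro curve_in_compose \<gamma>) auto
  from smooth_map_has_derivative_along[OF \<psi>_smooth this]
  have 1: "((\<lambda>t. \<psi> (body_normal a (\<gamma> t))) has_vector_derivative
       d\<psi> (body_normal a (q, R)) (tangent_map P (body_normal a) (q, R) (v, R'))) (at 0)"
    by (simp add: o_def)
  have 2: "((\<lambda>t. fst (\<gamma> t)) has_vector_derivative v) (at 0)" "((\<lambda>t. snd (\<gamma> t)) has_vector_derivative R') (at 0)"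
    using bounded_linear.has_vector_derivative[OF bounded_linear_fst d]
      bounded_linear.has_vector_derivative[OF bounded_linear_snd d] by simp_all
  from has_vector_derivative_diff[OF 2(1) bounded_bilinear.has_vector_derivative[OF bounded_bilinear_matrix_vector_mult 2(2) 1]]
  have 3: "((\<lambda>t. fst (\<gamma> t) - snd (\<gamma> t) *v \<psi> (body_normal a (\<gamma> t))) has_vector_derivative
     v - (R *v d\<psi> (body_normal a (q, R)) (tangent_map P (body_normal a) (q, R) (v, R'))
         + R' *v \<psi> (body_normal a (q, R)))) (at 0)"
    by (simp add: e(3))
  show "((body_center a \<Sigma> N \<circ> \<gamma>) has_vector_derivative
     v - (R *v d\<psi> (body_normal a (q, R)) (tangent_map P (body_normal a) (q, R) (v, R'))
         + R' *v \<psi> (body_normal a (q, R)))) (at 0)"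
  proof (rule has_vector_derivative_near[OF 3, where A = "{-e<..<e}"])
    fix t assume "t \<in> {-e<..<e}"
    then have "\<gamma> t \<in> P" using e(2) by blast
    then show "fst (\<gamma> t) - snd (\<gamma> t) *v \<psi> (body_normal a (\<gamma> t)) = (body_center a \<Sigma> N \<circ> \<gamma>) t"
      by (cases "\<gamma> t") (simp add: body_center_eq)
  qed (use e in auto)
qed

text \<open>After cancelling the terms that contain the contact point, the no-slip condition says that the
contact point moves with the same velocity on both surfaces, the one on the body being
the image under the differential of \<open>\<psi>\<close> of the velocity of the normal. Applying the
inverse differential gives the equation for \<open>cross3 w q\<close>.\<close>

lemma no_slip_iff:
  assumes p: "(q, R) \<in> P" and v: "q \<bullet> v = 0"
  shows "no_slip a \<Sigma> N (q, R) (v, cross_mat w ** R) w \<longleftrightarrow>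
    cross3 w q = v + a *\<^sub>R dN_displaced \<Sigma> N (body_motion a \<Sigma> N (q, R)) q v"
proof -
  let ?u = "body_normal a (q, R)" and ?d = "cross3 w q - v"
  let ?u' = "(1 / a) *\<^sub>R (transpose R *v ?d)" and ?A = "tangent_map \<Sigma> N (\<psi> (body_normal a (q, R)))"
  have R: "R \<in> SO3" using p by (simp add: config_space_iff)
  have u: "?u \<in> sphere 0 1" by (rule body_normal_sphere[OF a p])
  have T: "(v, cross_mat w ** R) \<in> tangent_space P (q, R)"
    using v by (auto simp: tangent_space_config[OF p a])
  have pd: "?u \<bullet> ?u' = 0" and pv: "?u \<bullet> (transpose R *v v) = 0"
    using perp_body_normal_iff[OF p a] v by (simp_all add: inner_diff_right dot_cross_self)
  have "no_slip a \<Sigma> N (q, R) (v, cross_mat w ** R) w \<longleftrightarrow> v = R *v d\<psi> ?u ?u'"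
    unfolding no_slip_def tangent_body_center[OF p T] tangent_body_normal[OF p a T] fst_conv body_center_eq[OF p]
    by (simp add: matrix_vector_mul_assoc[symmetric])
  also have "\<dots> \<longleftrightarrow> transpose R *v v = d\<psi> ?u ?u'"
    using SO3_inverse_vec[OF R, of v] SO3_inverse_vec[OF R, of "d\<psi> ?u ?u'"] by auto
  also have "\<dots> \<longleftrightarrow> ?A (transpose R *v v) = ?u'"
    using dN_d\<psi>[OF u pd] d\<psi>_dN(1)[OF u pv] by auto
  also have "\<dots> \<longleftrightarrow> R *v ?A (transpose R *v v) = (1 / a) *\<^sub>R ?d"
  proof
    assume A: "?A (transpose R *v v) = ?u'"
    show "R *v ?A (transpose R *v v) = (1 / a) *\<^sub>R ?d"
      unfolding A by (simp add: matrix_vector_mult_scaleR SO3_inverse_vec[OF R])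
  next
    assume "R *v ?A (transpose R *v v) = (1 / a) *\<^sub>R ?d"
    then have "transpose R *v (R *v ?A (transpose R *v v)) = transpose R *v ((1 / a) *\<^sub>R ?d)" by simp
    then show "?A (transpose R *v v) = ?u'"
      by (simp add: SO3_inverse_vec[OF R] matrix_vector_mult_scaleR)
  qed
  also have "\<dots> \<longleftrightarrow> cross3 w q = v + a *\<^sub>R (R *v ?A (transpose R *v v))"
    using a by (auto simp: eq_vector_fraction_iff eq_diff_eq add.commute)
  finally show ?thesis by (simp add: dN_body[OF p v])
qed

lemma constraints_iff:
  assumes p: "(q, R) \<in> P" and v: "q \<bullet> v = 0"
  shows "no_slip a \<Sigma> N (q, R) (v, cross_mat w ** R) w \<and> no_twist a (q, R) w \<longleftrightarrow>
    w = cross3 ((1 / a) *\<^sub>R q)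
          (dN_displaced \<Sigma> N (body_motion a \<Sigma> N (q, R)) q v + (1 / a) *\<^sub>R v)"
proof -
  let ?D = "dN_displaced \<Sigma> N (body_motion a \<Sigma> N (q, R)) q v"
  have R: "R \<in> SO3" and q: "norm q = a" using p by (simp_all add: config_space_iff)
  have "body_normal a (q, R) \<bullet> (transpose R *v v) = 0" using perp_body_normal_iff[OF p a] v by simp
  from d\<psi>_dN(2)[OF body_normal_sphere[OF a p] this] perp_body_normal_iff[OF p a, of ?D]
  have "q \<bullet> ?D = 0" by (simp add: dN_body[OF p v] SO3_inverse_vec[OF R])
  then have z: "q \<bullet> (v + a *\<^sub>R ?D) = 0" using v by (simp add: inner_add_right)
  have "(1 / a\<^sup>2) *\<^sub>R cross3 q (v + a *\<^sub>R ?D) = cross3 ((1 / a) *\<^sub>R q) (?D + (1 / a) *\<^sub>R v)"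
    using a by (simp add: cross_add_right cross_mult_right cross_mult_left power2_eq_square algebra_simps)
  then show ?thesis
    using cross_eq_solution[OF q a z, of w] by (simp add: no_slip_iff[OF p v] no_twist_iff[OF a])
qed

end


section \<open>The principal connection\<close>

context rolling_body
begin

abbreviation H :: "config \<Rightarrow> config set" where "H \<equiv> rolling_distribution a \<Sigma> N"

text \<open>If \<open>y\<close> is the image of \<open>w\<close> under the differential of \<open>\<psi>\<close> at the body normal of \<open>p\<close>, this is the
horizontal vector along which the body normal moves with velocity \<open>w\<close> and the contact point on
the body, in the body frame, with velocity \<open>y\<close>. Keeping \<open>y\<close> as an argument allows the derivative of a local
extension of \<open>\<psi>\<close> to stand in for the differential, which makes smoothness and linearity in \<open>w\<close> visible.\<close>

definition lift :: "config \<Rightarrow> real^3 \<Rightarrow> real^3 \<Rightarrow> config" where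
  "lift p w y = (snd p *v y,
     cross_mat (cross3 ((1 / a) *\<^sub>R fst p) (snd p *v w + (1 / a) *\<^sub>R (snd p *v y))) ** snd p)"

lemma lift_linear:
  assumes "linear C"
  shows "linear (\<lambda>w. lift p w (C w))"
  unfolding lift_def linear_iff
  by (auto simp: linear_add[OF assms] linear_cmul[OF assms] matrix_vector_right_distrib matrix_vector_mult_scaleR
      bounded_bilinear.add_left[OF bounded_bilinear_matrix_matrix_mult, symmetric]
      bounded_bilinear.scaleR_left[OF bounded_bilinear_matrix_matrix_mult, symmetric]
      linear_add[OF bounded_linear.linear[OF bounded_linear_cross_mat], symmetric]
      linear_cmul[OF bounded_linear.linear[OF bounded_linear_cross_mat], symmetric]
      bounded_bilinear.add_right[OF bounded_bilinear_cross3, symmetric]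
      bounded_bilinear.scaleR_right[OF bounded_bilinear_cross3, symmetric]
      algebra_simps)

lemma rolling_distribution_eq:
  assumes p: "(q, R) \<in> P"
  defines "u \<equiv> body_normal a (q, R)"
  shows "H (q, R) = (\<lambda>w. lift (q, R) w (d\<psi> u w)) ` {w. u \<bullet> w = 0}"
proof -
  have R: "R \<in> SO3" using p by (simp add: config_space_iff)
  have u: "u \<in> sphere 0 1" unfolding u_def by (rule body_normal_sphere[OF a p])
  let ?D = "\<lambda>v. dN_displaced \<Sigma> N (body_motion a \<Sigma> N (q, R)) q v"
  let ?w = "\<lambda>v. cross3 ((1 / a) *\<^sub>R q) (?D v + (1 / a) *\<^sub>R v)"
  have "H (q, R) = {(v, cross_mat (?w v) ** R) | v. q \<bullet> v = 0}"
  proof (intro equalityI subsetI)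
    fix x assume "x \<in> H (q, R)"
    then obtain v z w where "x = (v, cross_mat z ** R)" and v: "q \<bullet> v = 0"
      and "angular_velocity R (snd x) w" and w: "no_slip a \<Sigma> N (q, R) x w" "no_twist a (q, R) w"
      unfolding rolling_distribution_def tangent_space_config[OF p a] by auto
    then have x: "x = (v, cross_mat w ** R)" by (simp add: angular_velocity_iff[OF R])
    then have "w = ?w v" using constraints_iff[OF p v, of w] w by simp
    with v x show "x \<in> {(v, cross_mat (?w v) ** R) | v. q \<bullet> v = 0}" by blast
  next
    fix x assume "x \<in> {(v, cross_mat (?w v) ** R) | v. q \<bullet> v = 0}"
    then obtain v where v: "q \<bullet> v = 0" and x: "x = (v, cross_mat (?w v) ** R)" by blast
    have "angular_velocity R (snd x) (?w v)" by (simp add: x angular_velocity_iff[OF R])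
    moreover have "no_slip a \<Sigma> N (q, R) x (?w v) \<and> no_twist a (q, R) (?w v)"
      unfolding x constraints_iff[OF p v] ..
    moreover have "x \<in> tangent_space P (q, R)"
      unfolding tangent_space_config[OF p a] using x v by blast
    ultimately show "x \<in> H (q, R)" unfolding rolling_distribution_def by auto
  qed
  also have "\<dots> = (\<lambda>w. lift (q, R) w (d\<psi> u w)) ` {w. u \<bullet> w = 0}"
  proof (intro equalityI subsetI)
    fix x assume "x \<in> {(v, cross_mat (?w v) ** R) | v. q \<bullet> v = 0}"
    then obtain v where v: "q \<bullet> v = 0" and x: "x = (v, cross_mat (?w v) ** R)" by blast
    let ?w' = "tangent_map \<Sigma> N (\<psi> u) (transpose R *v v)"
    have "u \<bullet> (transpose R *v v) = 0" using perp_body_normal_iff[OF p a] v by (simp add: u_def)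
    from d\<psi>_dN(1,2)[OF u this] have "u \<bullet> ?w' = 0" "lift (q, R) ?w' (d\<psi> u ?w') = x"
      by (simp_all add: x lift_def SO3_inverse_vec[OF R] dN_body[OF p v] u_def)
    then show "x \<in> (\<lambda>w. lift (q, R) w (d\<psi> u w)) ` {w. u \<bullet> w = 0}" by force
  next
    fix x assume "x \<in> (\<lambda>w. lift (q, R) w (d\<psi> u w)) ` {w. u \<bullet> w = 0}"
    then obtain w where w: "u \<bullet> w = 0" and x: "x = lift (q, R) w (d\<psi> u w)" by blast
    let ?v = "R *v d\<psi> u w"
    have "u \<bullet> d\<psi> u w = 0" by (intro tangent_perp u d\<psi>_tangent w)
    then have v: "q \<bullet> ?v = 0"
      using perp_body_normal_iff[OF p a, of ?v] by (simp add: u_def SO3_inverse_vec[OF R])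
    have "?D ?v = R *v w"
      using dN_body[OF p v] dN_d\<psi>[OF u w] by (simp add: u_def SO3_inverse_vec[OF R])
    then have "x = (?v, cross_mat (?w ?v) ** R)" by (simp add: x lift_def)
    with v show "x \<in> {(v, cross_mat (?w v) ** R) | v. q \<bullet> v = 0}" by blast
  qed
  finally show ?thesis .
qed

lemma lift_tangent:
  assumes p: "(q, R) \<in> P" and w: "body_normal a (q, R) \<bullet> w = 0"
  shows "lift (q, R) w (d\<psi> (body_normal a (q, R)) w) \<in> tangent_space P (q, R)"
proof -
  have "lift (q, R) w (d\<psi> (body_normal a (q, R)) w) \<in> H (q, R)"
    unfolding rolling_distribution_eq[OF p] using w by blast
  then show ?thesis unfolding rolling_distribution_def by blast
qed

lemma tangent_bundle_proj:
  assumes p: "(q, R) \<in> P" and u: "(v, cross_mat w ** R) \<in> tangent_space P (q, R)"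
  shows "tangent_map P (bundle_proj a) (q, R) (v, cross_mat w ** R) = (1 / a) *\<^sub>R (transpose R *v (v - cross3 w q))"
proof -
  have "tangent_map P (body_normal a) (q, R) (v, cross_mat w ** R)
      = - ((1 / a) *\<^sub>R (transpose R *v v + transpose (cross_mat w ** R) *v q))"
    by (rule tangent_map_has_derivative[OF body_normal_derivative refl u, simplified])
  moreover have "- body_normal a x = bundle_proj a x" if "x \<in> P" for x
    using that by (simp add: body_normal_eq)
  from tangent_map_has_derivative[OF has_derivative_minus[OF body_normal_derivative] this u]
  have "tangent_map P (bundle_proj a) (q, R) (v, cross_mat w ** R)
      = (1 / a) *\<^sub>R (transpose R *v v + transpose (cross_mat w ** R) *v q)"
    by simp
  ultimately have neg: "tangent_map P (bundle_proj a) (q, R) (v, cross_mat w ** R)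
      = - tangent_map P (body_normal a) (q, R) (v, cross_mat w ** R)"
    by simp
  show ?thesis
    unfolding neg tangent_body_normal[OF p a u] by (simp add: matrix_vector_mult_diff_distrib scaleR_diff_right)
qed

text \<open>Up to sign, the differential of the projection recovers the parameter of a horizontal vector.
Therefore the horizontal space meets the vertical one only in zero and maps onto the tangent
plane of the base.\<close>

lemma tangent_bundle_proj_lift:
  assumes p: "(q, R) \<in> P" and w: "body_normal a (q, R) \<bullet> w = 0"
  shows "tangent_map P (bundle_proj a) (q, R) (lift (q, R) w (d\<psi> (body_normal a (q, R)) w)) = - w"
proof -
  let ?u = "body_normal a (q, R)"
  let ?y = "d\<psi> ?u w"
  let ?z = "R *v w + (1 / a) *\<^sub>R (R *v ?y)"
  have R: "R \<in> SO3" and q: "norm q = a" using p by (simp_all add: config_space_iff)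
  have u: "?u \<in> sphere 0 1" by (rule body_normal_sphere[OF a p])
  have "?u \<bullet> ?y = 0" by (intro tangent_perp u d\<psi>_tangent w)
  then have z: "q \<bullet> ?z = 0"
    using perp_body_normal_iff[OF p a, of "R *v ?y"] perp_body_normal_iff[OF p a, of "R *v w"] w
    by (simp add: SO3_inverse_vec[OF R] inner_add_right)
  have "cross3 (cross3 ((1 / a) *\<^sub>R q) ?z) q = a *\<^sub>R ?z"
  proof -
    have "cross3 ((1 / a) *\<^sub>R q) ?z = a *\<^sub>R (cross3 q ?z /\<^sub>R a\<^sup>2)"
      using a by (simp add: cross_mult_left power2_eq_square divide_inverse)
    then show ?thesis
      by (simp only: cross_mult_left[of a "cross3 q ?z /\<^sub>R a\<^sup>2"] cross_on_perp[OF z q a])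
  qed
  then have "R *v ?y - cross3 (cross3 ((1 / a) *\<^sub>R q) ?z) q = - a *\<^sub>R (R *v w)"
    using a by (simp add: scaleR_add_right)
  then show ?thesis
    using tangent_bundle_proj[OF p lift_tangent[OF p w, unfolded lift_def fst_conv snd_conv]] a
    by (simp add: lift_def matrix_vector_mult_scaleR SO3_inverse_vec[OF R]
        bounded_bilinear.minus_right[OF bounded_bilinear_matrix_vector_mult])
qed

lemma lift_action:
  assumes "S \<in> SO3"
  shows "lift (diag_action S p) w y = (\<lambda>(v, R'). (S *v v, S ** R')) (lift p w y)"
proof -
  have "cross_mat (S *v z) ** (S ** R) = S ** (cross_mat z ** R)" for z R
    by (simp add: matrix_mul_assoc SO3_conj_cross_mat[OF assms])
  moreover have "cross3 ((1 / a) *\<^sub>R (S *v q)) (S *v z + (1 / a) *\<^sub>R (S *v y)) = S *v cross3 ((1 / a) *\<^sub>R q) (z + (1 / a) *\<^sub>R y)" for q z y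
    by (simp add: SO3_cross[OF assms, symmetric] matrix_vector_mult_scaleR matrix_vector_right_distrib)
  ultimately show ?thesis
    by (cases p) (simp add: lift_def diag_action_def matrix_vector_mul_assoc[symmetric])
qed

lemma tangent_action:
  assumes "u \<in> tangent_space P p"
  shows "tangent_map P (diag_action S) p u = (\<lambda>(v, R'). (S *v v, S ** R')) u"
proof -
  have "(diag_action S has_derivative (\<lambda>u. (S *v fst u, S ** snd u))) (at p)"
    unfolding diag_action_def case_prod_beta
    by (intro has_derivative_Pair
        bounded_linear.has_derivative[OF bounded_bilinear.bounded_linear_right[OF bounded_bilinear_matrix_vector_mult]]
        bounded_linear.has_derivative[OF bounded_bilinear.bounded_linear_right[OF bounded_bilinear_matrix_matrix_mult]]
        has_derivative_fst has_derivative_snd has_derivative_ident)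
  from tangent_map_has_derivative[OF this refl assms] show ?thesis by (simp add: case_prod_beta)
qed

lemma unit_vector_eq_cross:
  fixes u :: "real^3"
  assumes "norm u = 1"
  obtains c1 c2 where "cross3 c1 c2 = u"
proof -
  obtain c :: "real^3" where c: "norm c = 1" "u \<bullet> c = 0"
  proof -
    obtain k :: "real^3" where k: "cross3 u k \<noteq> 0"
      using cross_basis_nonzero[of u] assms by fastforce
    show thesis
      by (rule that[of "cross3 u k /\<^sub>R norm (cross3 u k)"]) (use k in \<open>simp_all add: dot_cross_self\<close>)
  qed
  have "cross3 c (cross3 u c) = u"
    using c by (simp add: Lagrange norm_eq_1 inner_commute)
  then show thesis by (rule that)
qed

text \<open>The vectors \<open>cross3 u c1\<close> and \<open>cross3 u c2\<close> frame the plane orthogonal to \<open>u\<close> as long as \<open>u\<close> stays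
off the plane of \<open>c1\<close> and \<open>c2\<close>. The coefficients come from expanding the triple product
\<open>cross3 u (cross3 w (cross3 c1 c2))\<close> in two ways.\<close>

lemma perp_eq_span:
  fixes u :: "real^3"
  assumes "u \<bullet> cross3 c1 c2 \<noteq> 0"
  shows "{w. u \<bullet> w = 0} = span {cross3 u c1, cross3 u c2}"
proof (intro equalityI subsetI)
  fix w assume "w \<in> {w. u \<bullet> w = 0}"
  then have "cross3 u (cross3 w (cross3 c1 c2)) = (u \<bullet> cross3 c1 c2) *\<^sub>R w"
    by (simp add: Lagrange[of u])
  moreover have "cross3 u (cross3 w (cross3 c1 c2)) = (w \<bullet> c2) *\<^sub>R cross3 u c1 - (w \<bullet> c1) *\<^sub>R cross3 u c2"
    by (simp add: Lagrange[of w] Cross3.right_diff_distrib cross_mult_right)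
  ultimately have "w = (1 / (u \<bullet> cross3 c1 c2)) *\<^sub>R ((w \<bullet> c2) *\<^sub>R cross3 u c1 - (w \<bullet> c1) *\<^sub>R cross3 u c2)"
    using assms by (simp add: eq_vector_fraction_iff)
  also have "\<dots> \<in> span {cross3 u c1, cross3 u c2}"
    by (intro span_mul span_diff) (auto intro: span_base)
  finally show "w \<in> span {cross3 u c1, cross3 u c2}" .
next
  fix w assume "w \<in> span {cross3 u c1, cross3 u c2}"
  moreover have "span {cross3 u c1, cross3 u c2} \<subseteq> {w. u \<bullet> w = 0}"
    by (intro span_minimal subspace_hyperplane) (auto simp: dot_cross_self)
  ultimately show "w \<in> {w. u \<bullet> w = 0}" by blast
qed

lemma dim_rolling_distribution:
  assumes p: "(q, R) \<in> P"
  shows "dim (H (q, R)) = 2"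
proof -
  let ?u = "body_normal a (q, R)"
  have u: "?u \<in> sphere 0 1" by (rule body_normal_sphere[OF a p])
  then have u0: "?u \<noteq> 0" by auto
  let ?W = "{w. ?u \<bullet> w = 0}"
  obtain C where C: "linear C" "\<And>w. ?u \<bullet> w = 0 \<Longrightarrow> d\<psi> ?u w = C w" using d\<psi>_linear[OF u] by blast
  have "inj_on (\<lambda>w. lift (q, R) w (C w)) ?W"
    by (rule inj_on_inverseI[where g = "\<lambda>x. - tangent_map P (bundle_proj a) (q, R) x"])
       (use C(2) tangent_bundle_proj_lift[OF p] in force)
  then have "dim ((\<lambda>w. lift (q, R) w (C w)) ` ?W) = dim ?W"
    using lift_linear[OF C(1)]
    by (intro dim_image_eq) (simp_all add: subspace_hyperplane span_eq_iff[THEN iffD2])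
  moreover have "H (q, R) = (\<lambda>w. lift (q, R) w (C w)) ` ?W"
    unfolding rolling_distribution_eq[OF p] using C(2) by (intro image_cong) auto
  ultimately show ?thesis using dim_hyperplane[OF u0] by simp
qed

text \<open>Near a given configuration the horizontal lifts of the two moving vectors \<open>cross3 u c1\<close> and
\<open>cross3 u c2\<close> form a smooth frame, with \<open>c1\<close> and \<open>c2\<close> chosen so that their cross product is the
body normal there.\<close>

lemma smooth_rolling_distribution: "smooth_distribution P H"
  unfolding smooth_distribution_def
proof
  fix p assume p: "p \<in> P"
  let ?bn = "body_normal a"
  have u: "?bn p \<in> sphere 0 1" by (rule body_normal_sphere[OF a p])
  obtain V F where V: "open V" "?bn p \<in> V" "smooth_on_open V F" "\<And>x. x \<in> sphere 0 1 \<inter> V \<Longrightarrow> F x = \<psi> x"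
    using smooth_mapE[OF \<psi>_smooth u] by metis
  obtain c1 c2 where c: "cross3 c1 c2 = ?bn p" using unit_vector_eq_cross[of "?bn p"] u by auto
  define U where "U = ?bn -` (V \<inter> {x. x \<bullet> cross3 c1 c2 \<noteq> 0})"
  have cont: "continuous_on UNIV ?bn" by (rule smooth_imp_continuous[OF smooth_body_normal])
  have "open (V \<inter> {x. x \<bullet> cross3 c1 c2 \<noteq> 0})"
    by (intro open_Int V open_Collect_neq continuous_intros)
  then have U: "open U" unfolding U_def by (intro open_vimage cont)
  have pU: "p \<in> U"
    unfolding U_def using V(2) u c by auto
  define X where "X = (\<lambda>(i::nat) p. let w = cross3 (?bn p) (if i = 0 then c1 else c2)
     in lift p w (frechet_derivative F (at (?bn p)) w))"
  have smX: "smooth_on_open U (X i)" for i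
  proof -
    have bn: "smooth_on_open U ?bn" by (rule smooth_subset[OF smooth_body_normal]) simp
    have w: "smooth_on_open U (\<lambda>p. cross3 (?bn p) c)" for c
      by (intro smooth_intros bn U)
    have y: "smooth_on_open U (\<lambda>p. frechet_derivative F (at (?bn p)) (cross3 (?bn p) c))" for c
      by (rule smooth_frechet_derivative_compose[OF U V(1) _ V(3) bn w]) (auto simp: U_def)
    show ?thesis
      unfolding X_def Let_def lift_def by (intro smooth_intros U w y)
  qed
  have HX: "H x = span ((\<lambda>i. X i x) ` {..<2}) \<and> dim (H x) = 2" if x: "x \<in> P \<inter> U" for x
  proof -
    obtain q R where qR: "x = (q, R)" by fastforce
    have xP: "(q, R) \<in> P" using x qR by simp
    let ?u = "?bn x" and ?C = "frechet_derivative F (at (?bn x))"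
    have ux: "?u \<in> sphere 0 1" "?u \<in> V" "?u \<bullet> cross3 c1 c2 \<noteq> 0"
      using x body_normal_sphere[OF a] by (auto simp: U_def)
    have C: "linear ?C" by (rule has_derivative_linear[OF smooth_imp_derivative[OF V(3) ux(2)]])
    have "d\<psi> ?u w = ?C w" if "?u \<bullet> w = 0" for w
      using ux(1) that by (intro tangent_map_extension[OF V(1) ux(2) V(3,4)]) (auto simp: tangent_space_sphere)
    then have "H x = (\<lambda>w. lift x w (?C w)) ` {w. ?u \<bullet> w = 0}"
      unfolding qR rolling_distribution_eq[OF xP] by (intro image_cong) (auto simp: qR)
    also have "\<dots> = span ((\<lambda>w. lift x w (?C w)) ` {cross3 ?u c1, cross3 ?u c2})"
      unfolding perp_eq_span[OF ux(3)] by (rule linear_span_image[OF lift_linear[OF C], symmetric])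
    also have "(\<lambda>w. lift x w (?C w)) ` {cross3 ?u c1, cross3 ?u c2} = (\<lambda>i. X i x) ` {..<2}"
      by (simp add: X_def Let_def numeral_2_eq_2 lessThan_Suc insert_commute)
    finally show ?thesis using dim_rolling_distribution[OF xP] qR by simp
  qed
  show "\<exists>U k (X :: nat \<Rightarrow> config \<Rightarrow> config). open U \<and> p \<in> U \<and> (\<forall>i<k. smooth_map (P \<inter> U) (X i)) \<and>
      (\<forall>y\<in>P \<inter> U. H y = span ((\<lambda>i. X i y) ` {..<k}) \<and> dim (H y) = k)"
  proof (intro exI conjI ballI allI impI)
    show "open U" "p \<in> U" by (fact U pU)+
    show "smooth_map (P \<inter> U) (X i)" if "i < 2" for i
      by (rule smooth_mapI[OF U _ smX refl]) simp
    show "H y = span ((\<lambda>i. X i y) ` {..<2})" "dim (H y) = 2" if "y \<in> P \<inter> U" for y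
      using HX[OF that] by (rule conjunct1 conjunct2)+
  qed
qed

text \<open>A tangent vector \<open>x\<close> is split by taking the lift whose projection agrees with that of \<open>x\<close>; the
rest is vertical. Equivariance holds because the diagonal action fixes the body normal and
rotates lifts.\<close>

lemma principal_connection_rolling:
  "principal_connection SO3 diag_action P (bundle_proj a) H"
  unfolding principal_connection_def
proof (intro conjI ballI)
  fix p assume "p \<in> P"
  then obtain q R where qR: "p = (q, R)" and p: "(q, R) \<in> P" by (cases p) auto
  let ?u = "body_normal a (q, R)" and ?dp = "tangent_map P (bundle_proj a) (q, R)"
  let ?X = "\<lambda>w. lift (q, R) w (d\<psi> ?u w)"
  have R: "R \<in> SO3" using p by (simp add: config_space_iff)
  have u: "?u \<in> sphere 0 1" by (rule body_normal_sphere[OF a p])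
  obtain C where C: "linear C" "\<And>w. ?u \<bullet> w = 0 \<Longrightarrow> d\<psi> ?u w = C w" using d\<psi>_linear[OF u] by blast
  note L = lift_linear[OF C(1), of "(q, R)"]
  have HC: "H (q, R) = (\<lambda>w. lift (q, R) w (C w)) ` {w. ?u \<bullet> w = 0}"
    unfolding rolling_distribution_eq[OF p] using C(2) by (intro image_cong) auto
  show sub: "subspace (H p)"
    unfolding qR HC by (intro linear_subspace_image L subspace_hyperplane)
  show "H p \<subseteq> tangent_space P p" unfolding rolling_distribution_def by blast
  show "H p \<inter> vertical_space P (bundle_proj a) p = {0}"
  proof (intro equalityI subsetI)
    fix x assume x: "x \<in> H p \<inter> vertical_space P (bundle_proj a) p"
    then obtain w where w: "?u \<bullet> w = 0" "x = lift (q, R) w (C w)" unfolding qR HC by blast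
    have "- w = 0"
      using tangent_bundle_proj_lift[OF p w(1)] x w C(2) by (simp add: qR vertical_space_def)
    then show "x \<in> {0}" using linear_0[OF L] w(2) by simp
  next
    fix x :: config assume x: "x \<in> {0}"
    have 0: "0 \<in> H p" using sub by (rule subspace_0)
    then obtain w where w: "?u \<bullet> w = 0" "0 = lift (q, R) w (C w)" unfolding qR HC by blast
    have "?dp 0 = 0"
    proof -
      have "0 = lift (q, R) 0 (C 0)" using linear_0[OF L] by simp
      then show ?thesis using tangent_bundle_proj_lift[OF p, of 0] C(2)[of 0] by simp
    qed
    then show "x \<in> H p \<inter> vertical_space P (bundle_proj a) p"
      using 0 x unfolding vertical_space_def rolling_distribution_def by (simp add: qR)
  qed
  fix x assume x: "x \<in> tangent_space P p"
  then obtain v w where xv: "x = (v, cross_mat w ** R)" "q \<bullet> v = 0"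
    unfolding qR tangent_space_config[OF p a] by blast
  let ?c = "- ?dp x"
  have dx: "?dp x = (1 / a) *\<^sub>R (transpose R *v (v - cross3 w q))"
    using tangent_bundle_proj[OF p] x by (simp add: qR xv)
  have c: "?u \<bullet> ?c = 0"
    using perp_body_normal_iff[OF p a, of "v - cross3 w q"] xv(2)
    by (simp add: dx inner_diff_right dot_cross_self)
  obtain v' w' where h: "?X ?c = (v', cross_mat w' ** R)" "q \<bullet> v' = 0"
    using lift_tangent[OF p c] unfolding tangent_space_config[OF p a] by blast
  have h': "?dp (?X ?c) = (1 / a) *\<^sub>R (transpose R *v (v' - cross3 w' q))"
    using tangent_bundle_proj[OF p] lift_tangent[OF p c] by (simp add: h)
  have "?dp (?X ?c) = ?dp x" using tangent_bundle_proj_lift[OF p c] by simp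
  then have eq: "(1 / a) *\<^sub>R (transpose R *v (v - cross3 w q)) = (1 / a) *\<^sub>R (transpose R *v (v' - cross3 w' q))"
    by (rule trans[OF dx[symmetric] trans[OF sym h']])
  have d: "x - ?X ?c = (v - v', cross_mat (w - w') ** R)"
    unfolding h(1) by (simp add: xv linear_diff[OF bounded_linear.linear[OF bounded_linear_cross_mat]]
        bounded_bilinear.diff_left[OF bounded_bilinear_matrix_matrix_mult])
  have T: "x - ?X ?c \<in> tangent_space P p"
    unfolding d qR tangent_space_config[OF p a] using xv(2) h(2) by (auto simp: inner_diff_right)
  have "?dp (x - ?X ?c) = (1 / a) *\<^sub>R (transpose R *v (v - v' - cross3 (w - w') q))"
    using tangent_bundle_proj[OF p] T by (simp add: d qR)
  also have "\<dots> = (1 / a) *\<^sub>R (transpose R *v (v - cross3 w q)) - (1 / a) *\<^sub>R (transpose R *v (v' - cross3 w' q))"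
    by (simp add: Cross3.left_diff_distrib algebra_simps)
  finally have "x - ?X ?c \<in> vertical_space P (bundle_proj a) p"
    using eq T by (simp add: vertical_space_def qR)
  moreover have "?X ?c \<in> H p" unfolding qR rolling_distribution_eq[OF p] using c by blast
  ultimately show "\<exists>h\<in>H p. \<exists>w\<in>vertical_space P (bundle_proj a) p. x = h + w"
    by (intro bexI[of _ "?X ?c"] bexI[of _ "x - ?X ?c"]) auto
next
  fix S p assume S: "S \<in> SO3" and "p \<in> P"
  then obtain q R where qR: "p = (q, R)" and p: "(q, R) \<in> P" by (cases p) auto
  have Sp: "diag_action S (q, R) \<in> P" by (rule action_config_space[OF S p])
  have "H (diag_action S (q, R)) = (\<lambda>(v, R'). (S *v v, S ** R')) ` H (q, R)"
    using rolling_distribution_eq[of "S *v q" "S ** R"] Sp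
      body_normal_action[OF S p] lift_action[OF S, of "(q, R)"]
    by (simp add: rolling_distribution_eq[OF p] diag_action_def image_image)
  also have "\<dots> = tangent_map P (diag_action S) (q, R) ` H (q, R)"
    by (intro image_cong refl tangent_action[symmetric]) (auto simp: rolling_distribution_def)
  finally show "H (diag_action S p) = tangent_map P (diag_action S) p ` H p" by (simp add: qR)
next
  show "smooth_distribution P H" by (rule smooth_rolling_distribution)
qed

lemma spin_equivariant:
  assumes p: "(q, R) \<in> P" and v: "q \<bullet> v = 0" and S: "S \<in> SO3"
    and w: "cross3 w q = v + a *\<^sub>R dN_displaced \<Sigma> N (body_motion a \<Sigma> N (q, R)) q v" "w \<bullet> q = 0"
  shows "cross3 (S *v w) (S *v q) =
      S *v v + a *\<^sub>R dN_displaced \<Sigma> N (motion_comp (rotation_motion S) (body_motion a \<Sigma> N (q, R))) (S *v q) (S *v v)"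
    and "(S *v w) \<bullet> (S *v q) = 0"
  using w by (simp_all add: SO3_cross[OF S] SO3_inner[OF S] dN_rotated_body[OF p S v] dN_body[OF p v]
      matrix_vector_right_distrib matrix_vector_mult_scaleR)

end

theorem mainTheorem4:
  fixes a :: real and B \<Sigma> :: "(real^3) set" and \<mu> :: "(real^3) measure"
    and N\<^sub>2 :: "real^3 \<Rightarrow> real^3"
  assumes "a > 0"
    and "rigid_body B \<mu> \<Sigma>"
    and "standard_position \<mu>"
    and "gauss_map \<Sigma> N\<^sub>2"
    and "diffeo \<Sigma> (sphere 0 1) N\<^sub>2"
  shows
    "principal_bundle SO3 diag_action (config_space a) (bundle_proj a) (sphere 0 1) \<and>
     principal_connection SO3 diag_action (config_space a) (bundle_proj a)
       (rolling_distribution a \<Sigma> N\<^sub>2) \<and>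
     (\<forall>(q, R) \<in> config_space a. \<forall>(q', R') \<in> tangent_space (config_space a) (q, R). \<forall>\<omega>.
        angular_velocity R R' \<omega> \<longrightarrow>
        (no_slip a \<Sigma> N\<^sub>2 (q, R) (q', R') \<omega> \<and> no_twist a (q, R) \<omega> \<longleftrightarrow>
         \<omega> = cross3 ((1 / a) *\<^sub>R q)
               (dN_displaced \<Sigma> N\<^sub>2 (body_motion a \<Sigma> N\<^sub>2 (q, R)) q q' + (1 / a) *\<^sub>R q'))) \<and>
     (\<forall>(q, R) \<in> config_space a. \<forall>q' \<in> tangent_space (sphere 0 a) q. \<forall>\<omega>. \<forall>S\<in>SO3.
        let g = body_motion a \<Sigma> N\<^sub>2 (q, R) in
        cross3 \<omega> q = q' + a *\<^sub>R dN_displaced \<Sigma> N\<^sub>2 g q q' \<and> \<omega> \<bullet> q = 0 \<longrightarrow>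
        cross3 (S *v \<omega>) (S *v q) =
          S *v q' + a *\<^sub>R dN_displaced \<Sigma> N\<^sub>2 (motion_comp (rotation_motion S) g) (S *v q) (S *v q') \<and>
        (S *v \<omega>) \<bullet> (S *v q) = 0)"
proof -
  interpret rolling_body a \<Sigma> N\<^sub>2 using assms by unfold_locales
  have "no_slip a \<Sigma> N\<^sub>2 (q, R) (v, R') w \<and> no_twist a (q, R) w \<longleftrightarrow>
      w = cross3 ((1 / a) *\<^sub>R q) (dN_displaced \<Sigma> N\<^sub>2 (body_motion a \<Sigma> N\<^sub>2 (q, R)) q v + (1 / a) *\<^sub>R v)"
    if p: "(q, R) \<in> config_space a" and u: "(v, R') \<in> tangent_space (config_space a) (q, R)"
      and w: "angular_velocity R R' w" for q R v R' w
  proof -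
    have "R' = cross_mat w ** R" using w p by (simp add: angular_velocity_iff config_space_iff)
    moreover have "q \<bullet> v = 0" using u unfolding tangent_space_config[OF p a] by blast
    ultimately show ?thesis using constraints_iff[OF p] by simp
  qed
  moreover have "cross3 (S *v w) (S *v q) = S *v v + a *\<^sub>R dN_displaced \<Sigma> N\<^sub>2
        (motion_comp (rotation_motion S) (body_motion a \<Sigma> N\<^sub>2 (q, R))) (S *v q) (S *v v) \<and>
      (S *v w) \<bullet> (S *v q) = 0"
    if p: "(q, R) \<in> config_space a" and v: "v \<in> tangent_space (sphere 0 a) q" and S: "S \<in> SO3"
      and w: "cross3 w q = v + a *\<^sub>R dN_displaced \<Sigma> N\<^sub>2 (body_motion a \<Sigma> N\<^sub>2 (q, R)) q v" "w \<bullet> q = 0"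
    for q R v w S
  proof -
    have "q \<bullet> v = 0" using p v a by (simp add: tangent_space_sphere config_space_iff)
    from spin_equivariant[OF p this S w] show ?thesis ..
  qed
  ultimately show ?thesis
    using principal_bundle_config[OF a] principal_connection_rolling
    unfolding Let_def by (intro conjI) (assumption | force)+
qed

end
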